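(* Let $p$ be an odd prime, let $m$ be a positive integer, let $\mathrm{Tr}$ be the trace function from $\mathbb{F}_{p^m}$ to $\mathbb{F}_p$, and let $D=\{x\in\mathbb{F}_{p^m}^*:\mathrm{Tr}(x^2)=0\}=\{d_1,d_2,\dots,d_n\}$ (with $d_1,\dots,d_n$ distinct). Let $$C_{D,b}=\{(\mathrm{Tr}(ad_1)+b,\mathrm{Tr}(ad_2)+b,\dots,\mathrm{Tr}(ad_n)+b):a\in\mathbb{F}_{p^m},\,b\in\mathbb{F}_p\}.$$ (A) If $m\geqslant 3$ is odd, then $C_{D,b}$ is a $[p^{m-1}-1,\,m+1]$ code over $\mathbb{F}_p$ with complete weight enumerator \begin{align*} \mathrm{CWE}(C_{D,b})={}&\sum_{b=0}^{p-1}w_b^{p^{m-1}-1}+(p^{m-1}-1)\sum_{b=0}^{p-1}w_b^{p^{m-2}-1}\prod_{\substack{\rho=0\\ \rho\neq b}}^{p-1}w_\rho^{p^{m-2}}\\ &+\frac{p-1}{2}\left(p^{m-1}+p^{\frac{m-1}{2}}\right)\sum_{b=0}^{p-1}w_b^{p^{m-2}-1+(p-1)p^{\frac{m-3}{2}}}\prod_{\substack{\rho=0\\ \rho\neq b}}^{p-1}w_\rho^{p^{m-2}-p^{\frac{m-3}{2}}}\\ &+\frac{p-1}{2}\left(p^{m-1}-p^{\frac{m-1}{2}}\right)\sum_{b=0}^{p-1}w_b^{p^{m-2}-1-(p-1)p^{\frac{m-3}{2}}}\prod_{\substack{\rho=0\\ \rho\neq b}}^{p-1}w_\rho^{p^{m-2}+p^{\frac{m-3}{2}}}.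 \end{align*} (B) If $m\geqslant 2$ is even, then, writing $\varepsilon=(-1)^{\frac{m}{2}\left(\frac{p-1}{2}\right)^2}$, the code $C_{D,b}$ over $\mathbb{F}_p$ has parameters $$\left[\,p^{m-1}-1-\varepsilon(p-1)p^{\frac{m-2}{2}},\;m+1\,\right]$$ and complete weight enumerator \begin{align*} \mathrm{CWE}(C_{D,b})={}&\sum_{b=0}^{p-1}w_b^{p^{m-1}-1-\varepsilon(p-1)p^{\frac{m-2}{2}}}\\ &+\left(p^{m-1}-1-\varepsilon(p-1)p^{\frac{m-2}{2}}\right)\sum_{b=0}^{p-1}w_b^{p^{m-2}-1-\varepsilon(p-1)p^{\frac{m-2}{2}}}\prod_{\substack{\rho=0\\ \rho\neq b}}^{p-1}w_\rho^{p^{m-2}}\\ &+(p-1)\left(p^{m-1}+\varepsilon p^{\frac{m-2}{2}}\right)\sum_{b=0}^{p-1}w_b^{p^{m-2}-1}\prod_{\substack{\rho=0\\ \rho\neq b}}^{p-1}w_\rho^{p^{m-2}-\varepsilon p^{\frac{m-2}{2}}}. \end{align*}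
   Context: An $[n,\kappa]$ linear code over $\mathbb{F}_p$ is a $\kappa$-dimensional $\mathbb{F}_p$-subspace of $\mathbb{F}_p^n$. The subscript $b$ in $C_{D,b}$ is only part of the name of the code: $b$ ranges over all of $\mathbb{F}_p$ in its definition. Complete weight enumerator: attach to the elements $0,1,\dots,p-1$ of $\mathbb{F}_p$ formal commuting variables $w_0,w_1,\dots,w_{p-1}$. For $\mathsf{c}=(c_0,\dots,c_{n-1})\in\mathbb{F}_p^n$ put $w[\mathsf{c}]=w_0^{k_0}w_1^{k_1}\cdots w_{p-1}^{k_{p-1}}$, where $k_j$ is the number of coordinates of $\mathsf{c}$ equal to $j$ (so $\sum_j k_j=n$). The complete weight enumerator of a code $C\subseteq\mathbb{F}_p^n$ is $\mathrm{CWE}(C)=\sum_{\mathsf{c}\in C}w[\mathsf{c}]$.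
   Formalization: In (B) the dimension and the complete weight enumerator are claimed only when D is nonempty (n ≥ 1); this excludes exactly m = 2 with p ≡ 1 mod 4, where n = 0, the code is the zero space and the printed claim fails. *)

theory Defs
  imports
    "Berlekamp_Zassenhaus.Finite_Field"
    "Jordan_Normal_Form.VS_Connect"
    "HOL-Library.Poly_Mapping"
begin

text \<open>
  The field with \<open>p\<close> elements is \<open>'p mod_ring\<close> with \<open>CARD('p) = p\<close>; the class
  \<open>prime_card\<close> says that \<open>p\<close> is prime. The field with \<open>p ^ m\<close> elements is any finite field type
  of that cardinality.
\<close>

definition prime_field_emb :: "'p::prime_card mod_ring \<Rightarrow> 'k::field" where
  "prime_field_emb c = of_int (to_int_mod_ring c)"

text \<open>
  The absolute trace \<open>Tr(x) = x + x ^ p + \<dots> + x ^ (p ^ (m - 1))\<close>. If \<open>CARD('k) = CARD('p) ^ m\<close>,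
  then \<^const>\<open>prime_field_emb\<close> is an embedding of fields whose range contains this sum, so the
  description below picks out its unique preimage.
\<close>

definition field_trace :: "nat \<Rightarrow> 'k::{field,finite} \<Rightarrow> 'p::prime_card mod_ring" where
  "field_trace m x = (THE c. prime_field_emb c = (\<Sum>i<m. x ^ (CARD('p) ^ i)))"

text \<open>An \<open>[n, k]\<close> linear code: a \<open>k\<close>-dimensional subspace of the space of vectors of length \<open>n\<close>.\<close>

definition is_linear_code :: "nat \<Rightarrow> nat \<Rightarrow> 'f::field vec set \<Rightarrow> bool" where
  "is_linear_code n k C \<longleftrightarrow>
     VectorSpace.subspace class_ring C (module_vec TYPE('f) n) \<and>
     vectorspace.dim class_ring ((module_vec TYPE('f) n)\<lparr>carrier := C\<rparr>) = k"

text \<open>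
  Integer polynomials in commuting indeterminates indexed by \<open>'f\<close>: a monomial is a finitely
  supported exponent function \<open>'f \<Rightarrow>\<^sub>0 nat\<close>.
\<close>

type_synonym 'f enum_poly = "('f \<Rightarrow>\<^sub>0 nat) \<Rightarrow>\<^sub>0 int"

definition w :: "'f \<Rightarrow> 'f enum_poly" where
  "w j = Poly_Mapping.single (Poly_Mapping.single j 1) 1"

definition word_monom :: "'f::finite vec \<Rightarrow> 'f enum_poly" where
  "word_monom c = (\<Prod>j\<in>UNIV. w j ^ card {i. i < dim_vec c \<and> c $ i = j})"

definition CWE :: "'f::finite vec set \<Rightarrow> 'f enum_poly" where
  "CWE C = (\<Sum>c\<in>C. word_monom c)"

definition defining_set :: "'p::prime_card itself \<Rightarrow> nat \<Rightarrow> 'k::{field,finite} set" where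
  "defining_set _ m = {x. x \<noteq> 0 \<and> field_trace m (x ^ 2) = (0 :: 'p mod_ring)}"

definition trace_code ::
  "nat \<Rightarrow> nat \<Rightarrow> (nat \<Rightarrow> 'k::{field,finite}) \<Rightarrow> 'p::prime_card mod_ring vec set" where
  "trace_code m n d = {vec n (\<lambda>i. field_trace m (a * d i) + b) | a b. True}"

end

(* With V u the number of x such that Tr(x^2) = u, everything reduces to counting the isotropic x with
   Tr(ax) = 0 for fixed a, and this is done without Gauss sums. If Tr(a^2) = 0, translation by multiples
   of a suffices. If A = Tr(a^2) is nonzero, counting the pairs (x, r) with Tr(x^2) = A r^2 in
   two ways expresses the number through V 0 and V A. For odd m a nonsquare y of F_p stays a nonsquare, so
   V u + V (y u) = 2 p^(m-1), and the second moment of V gives the deviation of V from its mean up to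
   sign. For m = 2h the elements of F_q, q = p^h, are squares in the big field; the relative trace to
   F_q vanishes on a line r F_q, and the sign depends on whether r is a square, i.e. on (q + 1) / 2 mod 2. *)

theory Submission
  imports Defs "HOL-Number_Theory.Residues"
begin

section \<open>Counting and squares in finite fields\<close>

text \<open>One count per \<open>a\<close> fixes a whole codeword. Scaling by a nonzero element of
  F_p preserves isotropic vectors and multiplies Tr(ax), so all nonzero values of Tr(ax) occur
  equally often on D, and adding b only moves the exceptional symbol. The p words with a common
  \<open>a\<close> thus form one block of the enumerator. The obstacle to avoiding characters is a
  sign: the second moment sees only the square of the deviation of V. For odd m this is harmless,
  because the deviations sum to zero, so each sign occurs for (p - 1)/2 values u and both kinds of
  block appear in the result. For even m all nonzero u share one deviation whose sign is part of the
  answer; hence the detour through F_q. Sizes of trace fibres and of the subfield come from degree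
  bounds on polynomials: the bounds multiply up to exactly the size of the whole set, so each of
  them is attained. The dimension is read off from the number of codewords, so only injectivity of
  the parametrisation by (a, b) is at stake. That requires D to be nonempty.\<close>

lemma card_fibre_eq_of_le:
  assumes "finite A" "finite B" "f ` A \<subseteq> B" "card A = card B * N"
    and le: "\<And>b. b \<in> B \<Longrightarrow> card {x \<in> A. f x = b} \<le> N"
    and "b \<in> B"
  shows "card {x \<in> A. f x = b} = N"
proof (rule ccontr)
  assume "card {x \<in> A. f x = b} \<noteq> N"
  with le[OF \<open>b \<in> B\<close>] have lt: "card {x \<in> A. f x = b} < N" by simp
  have "card A = (\<Sum>b\<in>B. card {x \<in> A. f x = b})"
    using sum_fun_comp[OF assms(1-3), of "\<lambda>_. 1::nat"] by simp
  also have "\<dots> < (\<Sum>b\<in>B. N)"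
    by (rule sum_strict_mono_ex1) (use assms lt in auto)
  finally show False using assms(4) by simp
qed

lemma finite_field_power_card_minus_1:
  fixes x :: "'a::{field,finite}"
  assumes "x \<noteq> 0"
  shows "x ^ (CARD('a) - 1) = 1"
proof -
  have "bij_betw ((*) x) (UNIV - {0}) (UNIV - {0})"
    by (rule bij_betw_byWitness[where f' = "\<lambda>y. y / x"]) (use assms in auto)
  then have "(\<Prod>y\<in>UNIV - {0}. x * y) = \<Prod>(UNIV - {0})"
    using prod.reindex_bij_betw[of "(*) x" "UNIV - {0}" "UNIV - {0}" "\<lambda>y. y"] by simp
  then have "x ^ (CARD('a) - 1) * \<Prod>(UNIV - {0}) = \<Prod>(UNIV - {0::'a})"
    by (simp add: prod.distrib card_Diff_subset)
  moreover have "\<Prod>(UNIV - {0::'a}) \<noteq> 0" by simp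
  ultimately show ?thesis by simp
qed

lemma finite_field_power_card:
  fixes x :: "'a::{field,finite}"
  shows "x ^ CARD('a) = x"
proof (cases "x = 0")
  case False
  have "x ^ CARD('a) = x * x ^ (CARD('a) - 1)"
    by (rule power_eq_if[THEN trans]) simp
  then show ?thesis using finite_field_power_card_minus_1[OF False] by simp
qed (simp add: power_0_left)

lemma card_poly_fibre_le:
  fixes f :: "'a::idom poly"
  assumes "degree f = n" "n > 0"
  shows "card {x. poly f x = c} \<le> n"
proof -
  have "degree (f - [:c:]) = n"
    using degree_add_eq_left[of "- [:c:]" f] assms
    by (simp del: minus_pCons add_uminus_conv_diff flip: add_uminus_conv_diff)
  then have "f - [:c:] \<noteq> 0" using assms by auto
  then have "card {x. poly (f - [:c:]) x = 0} \<le> n"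
    using card_poly_roots_bound \<open>degree (f - [:c:]) = n\<close> by metis
  then show ?thesis by simp
qed

lemma card_power_eq_le:
  fixes c :: "'a::idom"
  assumes "n > 0"
  shows "card {x. x ^ n = c} \<le> n"
  using card_poly_fibre_le[of "monom (1::'a) n" n c] assms
  by (simp add: degree_monom_eq poly_monom)

lemma card_double_fibre:
  assumes "finite A" "finite B"
  shows "(\<Sum>a\<in>A. card {b \<in> B. R a b}) = (\<Sum>b\<in>B. card {a \<in> A. R a b})"
  using sum.swap_restrict[OF assms, of "\<lambda>_ _. 1::nat" R] by simp

text \<open>A nonzero square has exactly the two roots \<open>y\<close> and \<open>-y\<close>,
  distinct because \<open>2\<close> is nonzero. This moves counts over \<open>x\<close> to counts
  over squares, where Euler's criterion applies.\<close>

lemma card_eq_of_squares: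
  fixes P :: "'a::{field,finite} \<Rightarrow> bool"
  assumes "(2::'a) \<noteq> 0"
  shows "card {x. x \<noteq> 0 \<and> P (x\<^sup>2)} = 2 * card {s. s \<noteq> 0 \<and> (\<exists>x. s = x\<^sup>2) \<and> P s}"
proof -
  let ?S = "{s. s \<noteq> 0 \<and> (\<exists>x. s = x\<^sup>2) \<and> P s}"
  have fib: "card {x \<in> {x. x \<noteq> 0 \<and> P (x\<^sup>2)}. x\<^sup>2 = s} = 2" if "s \<in> ?S" for s
  proof -
    from that obtain y where y: "s = y\<^sup>2" by auto
    have "{x \<in> {x. x \<noteq> 0 \<and> P (x\<^sup>2)}. x\<^sup>2 = s} = {y, -y}"
      using that y by (auto simp: power2_eq_iff)
    moreover have "y \<noteq> -y"
    proof
      assume "y = -y"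
      then have "2 * y = 0" by (simp only: mult_2 eq_neg_iff_add_eq_0)
      then show False using that y assms by simp
    qed
    ultimately show ?thesis by simp
  qed
  have "card {x. x \<noteq> 0 \<and> P (x\<^sup>2)} = (\<Sum>s\<in>?S. card {x \<in> {x. x \<noteq> 0 \<and> P (x\<^sup>2)}. x\<^sup>2 = s})"
    using sum_fun_comp[of "{x. x \<noteq> 0 \<and> P (x\<^sup>2)}" ?S "\<lambda>x. x\<^sup>2" "\<lambda>_. 1::nat"]
    by (simp add: image_subset_iff) blast
  also have "\<dots> = (\<Sum>s\<in>?S. 2)" by (rule sum.cong[OF refl fib])
  finally show ?thesis by simp
qed

lemma card_nonzero_squares:
  assumes "(2::'a::{field,finite}) \<noteq> 0"
  shows "CARD('a) - 1 = 2 * card {s::'a. s \<noteq> 0 \<and> (\<exists>x. s = x\<^sup>2)}"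
proof -
  have "card {x::'a. x \<noteq> 0} = CARD('a) - 1"
    using card_Diff_subset[of "{0::'a}" UNIV] by (simp add: set_diff_eq)
  then show ?thesis using card_eq_of_squares[OF assms, of "\<lambda>_. True"] by simp
qed

text \<open>Euler's criterion: the nonzero squares already exhaust the roots of \<open>X ^ ((q - 1) / 2) - 1\<close>.\<close>

lemma finite_field_square_iff:
  fixes s :: "'a::{field,finite}"
  assumes "(2::'a) \<noteq> 0" "s \<noteq> 0"
  shows "(\<exists>x. s = x\<^sup>2) \<longleftrightarrow> s ^ ((CARD('a) - 1) div 2) = 1"
proof -
  let ?n = "(CARD('a) - 1) div 2" and ?S = "{s::'a. s \<noteq> 0 \<and> (\<exists>x. s = x\<^sup>2)}"
  have n: "CARD('a) - 1 = 2 * ?n" "card ?S = ?n"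
    using card_nonzero_squares[OF assms(1)] by auto
  have "card ?S > 0" by (auto simp: card_gt_0_iff intro!: exI[of _ 1])
  have "?S \<subseteq> {x. x ^ ?n = 1}"
  proof
    fix s assume "s \<in> ?S"
    then obtain x where x: "s = x\<^sup>2" "x \<noteq> 0" by auto
    have "s ^ ?n = x ^ (2 * ?n)" unfolding x(1) by (rule power_mult[symmetric])
    then show "s \<in> {x. x ^ ?n = 1}"
      using finite_field_power_card_minus_1[OF x(2)] n(1) by simp
  qed
  moreover have "card {x::'a. x ^ ?n = 1} \<le> card ?S"
    using card_power_eq_le[of ?n "1::'a"] n \<open>card ?S > 0\<close> by simp
  ultimately have "?S = {x. x ^ ?n = 1}"
    by (intro card_seteq) simp_all
  then show ?thesis using assms(2) by blast
qed

lemma one_neq_minus_one: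
  assumes "(2::'a::ring_1) \<noteq> 0"
  shows "(1::'a) \<noteq> -1"
proof
  assume "(1::'a) = -1"
  then have "(1::'a) + 1 = 0" by (simp only: eq_neg_iff_add_eq_0)
  then show False using assms by simp
qed

lemma finite_field_nonsquare_power:
  fixes s :: "'a::{field,finite}"
  assumes "(2::'a) \<noteq> 0" "s \<noteq> 0" "\<nexists>x. s = x\<^sup>2"
  shows "s ^ ((CARD('a) - 1) div 2) = -1"
proof -
  have "CARD('a) - 1 = ((CARD('a) - 1) div 2) * 2"
    using card_nonzero_squares[OF assms(1)] by simp
  then have "(s ^ ((CARD('a) - 1) div 2))\<^sup>2 = 1"
    using finite_field_power_card_minus_1[OF assms(2)] by (metis power_mult)
  then show ?thesis
    using finite_field_square_iff[OF assms(1,2)] assms(3) by (auto simp: power2_eq_1_iff)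
qed

text \<open>The power with exponent half of \<open>CARD('a) - 1\<close> is multiplicative, is 1 on
  nonzero squares and -1 on nonsquares, so a nonsquare factor flips it.\<close>

lemma finite_field_nonsquare_mult:
  fixes s t :: "'a::{field,finite}"
  assumes "(2::'a) \<noteq> 0" "s \<noteq> 0" "t \<noteq> 0" "\<nexists>x. t = x\<^sup>2"
  shows "(\<exists>x. t * s = x\<^sup>2) \<longleftrightarrow> (\<nexists>x. s = x\<^sup>2)"
proof -
  let ?n = "(CARD('a) - 1) div 2"
  have "(1::'a) \<noteq> -1" by (rule one_neq_minus_one[OF assms(1)])
  moreover have "s ^ ?n = 1 \<or> s ^ ?n = -1"
    using finite_field_nonsquare_power[OF assms(1,2)] finite_field_square_iff[OF assms(1,2)] by blast
  moreover have "(t * s) ^ ?n = - (s ^ ?n)"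
    using finite_field_nonsquare_power[OF assms(1,3,4)] by (simp add: power_mult_distrib)
  ultimately show ?thesis
    using finite_field_square_iff[OF assms(1), of "t * s"] finite_field_square_iff[OF assms(1,2)] assms(2,3)
    by auto
qed

text \<open>Change of variables that turns a difference of squares into a product. The four shapes
  are the ones in which the two factorisation bijections below meet them as rewrite rules.\<close>

lemma half_sum_diff:
  fixes x y :: "'a::field"
  assumes "(2::'a) \<noteq> 0"
  shows "(x + y) / 2 - (y - x) / 2 = x" "(x + y) / 2 + (y - x) / 2 = y"
    and "((x - y) + (x + y)) / 2 = x" "((x + y) - (x - y)) / 2 = y"
proof -
  have "(x + x) / 2 = x" "(y + y) / 2 = y"
    using assms by (simp_all flip: mult_2)
  then show "(x + y) / 2 - (y - x) / 2 = x" "(x + y) / 2 + (y - x) / 2 = y"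
    and "((x - y) + (x + y)) / 2 = x" "((x + y) - (x - y)) / 2 = y"
    by (simp_all flip: diff_divide_distrib add_divide_distrib)
qed

lemma sum_lessThan_add:
  fixes f :: "nat \<Rightarrow> 'a::comm_monoid_add"
  shows "(\<Sum>i<a + b. f i) = (\<Sum>i<a. f i) + (\<Sum>i<b. f (a + i))"
  by (induction b) (simp_all add: add.assoc)

text \<open>Links the sign in the theorem to the parity that Euler's criterion will produce. Both
  depend on \<open>p ^ h\<close> mod 4: it is always 1 if \<open>p\<close> is 1 mod 4, and
  alternates with \<open>h\<close> if \<open>p\<close> is 3 mod 4.\<close>

lemma odd_power_half_parity:
  fixes p h :: nat
  assumes "odd p"
  shows "(-1::int) ^ (h * ((p - 1) div 2)\<^sup>2) = (if even ((p ^ h + 1) div 2) then -1 else 1)"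
proof -
  from assms obtain k where k: "p = 2 * k + 1" by (auto elim: oddE)
  show ?thesis
  proof (cases "even k")
    case True
    then have "p mod 4 = 1" unfolding k by (auto elim!: evenE)
    then have "p ^ h mod 4 = 1" using power_mod[of p 4 h] by simp
    then obtain j where "p ^ h = 4 * j + 1" by (metis mod_mult_div_eq mult.commute add.commute)
    then show ?thesis using True k by simp
  next
    case False
    then have "p mod 4 = 3" unfolding k by (auto elim!: oddE)
    then have "p ^ h mod 4 = (if even h then 1 else 3)"
    proof (induction h)
      case (Suc h)
      have "p ^ Suc h mod 4 = (p mod 4) * (p ^ h mod 4) mod 4" by (simp add: mod_mult_eq)
      then show ?case using Suc by simp
    qed simp
    moreover have "even ((n + 1) div 2) \<longleftrightarrow> n mod 4 = 3" if "odd n" for n :: nat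
      using that by presburger
    ultimately have "even ((p ^ h + 1) div 2) \<longleftrightarrow> odd h" using assms by simp
    then show ?thesis using False k by (simp add: minus_one_power_iff)
  qed
qed

section \<open>The trace\<close>

locale odd_trace =
  fixes p m :: nat and P :: "'p::prime_card itself" and K :: "'k::{field,finite} itself"
  assumes card_p: "CARD('p) = p" and card_k: "CARD('k) = p ^ m" and m_pos: "m > 0" and odd_p: "odd p"
begin

abbreviation emb :: "'p mod_ring \<Rightarrow> 'k" where "emb \<equiv> prime_field_emb"

abbreviation tr :: "'k \<Rightarrow> 'p mod_ring" where "tr \<equiv> field_trace m"

lemma prime_p: "prime p"
  using prime_card[where ?'a = 'p] card_p by simp

lemma CHAR_F: "CHAR('p mod_ring) = p"
  using card_p by simp

lemma p_ge_3: "p \<ge> 3"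
  using prime_ge_2_nat[OF prime_p] odd_p by (cases "p = 2") auto

lemma CHAR_k: "CHAR('k) = p"
proof -
  have "CHAR('k) > 0" by (rule finite_imp_CHAR_pos) simp
  then have "prime CHAR('k)" by (rule prime_CHAR_semidom)
  moreover have "CHAR('k) dvd p ^ m" using CHAR_dvd_CARD[where ?'a = 'k] card_k by simp
  ultimately show ?thesis
    using prime_p prime_dvd_power primes_dvd_imp_eq by blast
qed

lemma prime_CHAR_k: "prime CHAR('k)"
  using CHAR_k prime_p by simp

lemma two_k: "(2::'k) \<noteq> 0"
proof
  assume "(2::'k) = 0"
  then have "p dvd 2" using of_nat_eq_0_iff_char_dvd[where ?'a = 'k, of 2] CHAR_k by simp
  then show False using p_ge_3 by (auto dest: dvd_imp_le)
qed

lemma two_F: "(2::'p mod_ring) \<noteq> 0"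
proof
  assume "(2::'p mod_ring) = 0"
  then have "p dvd 2" using of_nat_eq_0_iff_char_dvd[where ?'a = "'p mod_ring", of 2] CHAR_F by simp
  then show False using p_ge_3 by (auto dest: dvd_imp_le)
qed

section \<open>The prime field inside the big field\<close>

lemma of_int_mod_p: "of_int (a mod int p) = (of_int a :: 'k)"
proof -
  have "of_int a = (of_int (int p * (a div int p) + a mod int p) :: 'k)" by simp
  also have "\<dots> = of_nat p * of_int (a div int p) + of_int (a mod int p)"
    by (simp only: of_int_add of_int_mult of_int_of_nat_eq)
  also have "(of_nat p :: 'k) = 0"
    using of_nat_eq_0_iff_char_dvd[where ?'a = 'k, of p] CHAR_k by simp
  finally show ?thesis by simp
qed

lemma emb_add: "emb (x + y) = emb x + emb y"
  by (simp add: prime_field_emb_def to_int_mod_ring_add card_p of_int_mod_p)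

lemma emb_mult: "emb (x * y) = emb x * emb y"
  by (simp add: prime_field_emb_def to_int_mod_ring_mult card_p of_int_mod_p)

lemma emb_0 [simp]: "emb 0 = 0" and emb_1 [simp]: "emb 1 = 1"
  by (simp_all add: prime_field_emb_def)

lemma emb_eq_0_iff [simp]: "emb x = 0 \<longleftrightarrow> x = 0"
proof
  assume "emb x = 0"
  have "x * inverse x = 1" if "x \<noteq> 0" using that by simp
  then have "emb x * emb (inverse x) = 1" if "x \<noteq> 0" using that by (simp flip: emb_mult)
  with \<open>emb x = 0\<close> show "x = 0" by auto
qed simp

lemma emb_uminus: "emb (- x) = - emb x"
  using emb_add[of x "- x"] by (simp add: eq_neg_iff_add_eq_0 add.commute)

lemma emb_diff: "emb (x - y) = emb x - emb y"
  using emb_add[of x "- y"] by (simp add: emb_uminus)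

lemma inj_emb: "inj emb"
proof (rule injI)
  fix x y assume "emb x = emb y"
  then have "emb (x - y) = 0" by (simp only: emb_diff right_minus_eq)
  then show "x = y" by simp
qed

lemma emb_eq_iff [simp]: "emb x = emb y \<longleftrightarrow> x = y"
  using inj_emb by (auto dest: injD)

lemma emb_power: "emb (x ^ n) = emb x ^ n"
  by (induction n) (simp_all add: emb_mult)

lemma emb_fixed: "emb x ^ p = emb x"
  using finite_field_power_card_eq_same[of x] card_p by (simp flip: emb_power)

text \<open>The \<open>p\<close> images of \<open>emb\<close> are roots of X^p - X, which has no
  more than \<open>p\<close> roots.\<close>

lemma range_emb: "range emb = {x. x ^ p = x}"
proof (rule card_seteq)
  have "degree (monom 1 p - monom (1::'k) 1) = p"
    using degree_add_eq_left[of "- monom (1::'k) 1" "monom 1 p"] p_ge_3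
    by (simp add: degree_monom_eq)
  from card_poly_fibre_le[OF this, of 0] p_ge_3
  have "card {x::'k. x ^ p = x} \<le> p" by (simp add: poly_monom)
  then show "card {x::'k. x ^ p = x} \<le> card (range emb)"
    using card_image[OF inj_emb] card_p by simp
qed (use emb_fixed in auto)

section \<open>Frobenius powers, partial traces and the absolute trace\<close>

lemma frobenius_add: "(x + y :: 'k) ^ (p ^ i) = x ^ (p ^ i) + y ^ (p ^ i)"
  using freshmans_dream'[OF prime_CHAR_k] CHAR_k by metis

lemma frobenius_sum: "(sum f A :: 'k) ^ p = (\<Sum>x\<in>A. f x ^ p)"
  using freshmans_dream_sum[OF prime_CHAR_k] CHAR_k by metis

lemma frobenius_emb: "emb x ^ (p ^ i) = emb x"
  by (induction i) (simp_all add: power_mult emb_fixed)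

lemma frobenius_m: "(x::'k) ^ (p ^ m) = x"
  using finite_field_power_card[of x] card_k by simp

text \<open>The number of terms is left open so that the same arguments serve the whole field
  (\<open>h = m\<close>) and, on \<open>fixed_field h\<close>, the trace of the subfield with
  \<open>p ^ h\<close> elements (\<open>m = 2 * h\<close>).\<close>

definition partial_trace :: "nat \<Rightarrow> 'k \<Rightarrow> 'k" where
  "partial_trace h x = (\<Sum>i<h. x ^ (p ^ i))"

definition fixed_field :: "nat \<Rightarrow> 'k set" where
  "fixed_field h = {x. x ^ (p ^ h) = x}"

lemma partial_trace_add: "partial_trace h (x + y) = partial_trace h x + partial_trace h y"
  by (simp add: partial_trace_def frobenius_add sum.distrib)

lemma partial_trace_emb_mult: "partial_trace h (emb c * x) = emb c * partial_trace h x"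
  by (simp add: partial_trace_def power_mult_distrib frobenius_emb sum_distrib_left)

text \<open>Raising to the power \<open>p\<close> shifts the sum by one term; the term gained,
  \<open>x ^ (p ^ h)\<close>, equals the term lost, \<open>x\<close>. So the value is fixed by
  Frobenius.\<close>

lemma partial_trace_range:
  assumes "x \<in> fixed_field h"
  shows "partial_trace h x \<in> range emb"
proof -
  have "partial_trace h x ^ p = (\<Sum>i<h. x ^ (p ^ Suc i))"
    by (simp add: partial_trace_def frobenius_sum mult.commute flip: power_mult)
  also have "\<dots> + x = (\<Sum>i<h. x ^ (p ^ i)) + x ^ (p ^ h)"
    using sum.lessThan_Suc_shift[of "\<lambda>i. x ^ (p ^ i)" h] by (simp add: add.commute)
  finally have "partial_trace h x ^ p = partial_trace h x"
    using assms by (simp add: partial_trace_def fixed_field_def)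
  then show ?thesis by (simp add: range_emb)
qed

text \<open>The partial trace is a polynomial of degree \<open>p ^ (h - 1)\<close>, so each of its
  \<open>p\<close> possible fibres has at most that many elements. Together they must fill
  \<open>p ^ h\<close> elements, so no fibre is smaller.\<close>

lemma card_partial_trace_fibre:
  assumes "card (fixed_field h) = p ^ h" "h > 0"
  shows "card {x \<in> fixed_field h. partial_trace h x = emb c} = p ^ (h - 1)"
proof (rule card_fibre_eq_of_le[where B = "range emb"])
  have "card (range emb) * p ^ (h - 1) = p ^ h"
    using card_image[OF inj_emb] card_p \<open>h > 0\<close> by (simp add: power_eq_if)
  then show "card (fixed_field h) = card (range emb) * p ^ (h - 1)" using assms by simp
  let ?f = "\<Sum>i<h. monom (1::'k) (p ^ i)"
  have "degree ?f = p ^ (h - 1)"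
  proof -
    have "?f = (\<Sum>i<h-1. monom (1::'k) (p ^ i)) + monom 1 (p ^ (h - 1))"
      using \<open>h > 0\<close> by (cases h) simp_all
    moreover have "degree (\<Sum>i<h-1. monom (1::'k) (p ^ i)) < p ^ (h - 1)"
      using p_ge_3 by (intro degree_sum_less) (auto simp: degree_monom_eq intro: power_strict_increasing)
    ultimately show ?thesis by (simp add: degree_add_eq_right degree_monom_eq)
  qed
  then have "card {x. poly ?f x = y} \<le> p ^ (h - 1)" for y
    using card_poly_fibre_le p_ge_3 by (metis gr0I power_not_zero not_numeral_le_zero)
  moreover have "card {x \<in> fixed_field h. partial_trace h x = y} \<le> card {x. poly ?f x = y}" for y
    by (rule card_mono) (auto simp: poly_sum poly_monom partial_trace_def)
  ultimately show "card {x \<in> fixed_field h. partial_trace h x = y} \<le> p ^ (h - 1)" for y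
    using le_trans by blast
qed (use partial_trace_range in auto)

lemma fixed_field_m: "fixed_field m = UNIV"
  by (simp add: fixed_field_def frobenius_m)

text \<open>Discharges the definite description in \<open>field_trace\<close>: a preimage exists by
  Frobenius invariance and is unique because \<open>emb\<close> is injective.\<close>

lemma emb_tr: "emb (tr x) = partial_trace m x"
proof -
  have "partial_trace m x \<in> range emb"
    by (rule partial_trace_range) (simp add: fixed_field_m)
  then obtain c where c: "emb c = partial_trace m x" by auto
  have "tr x = c"
    unfolding field_trace_def using c card_p
    by (intro the_equality) (auto simp: partial_trace_def simp flip: emb_eq_iff)
  then show ?thesis using c by simp
qed

lemma tr_add: "tr (x + y) = tr x + tr y"
  by (simp add: emb_tr partial_trace_add emb_add flip: emb_eq_iff)

lemma tr_emb_mult: "tr (emb c * x) = c * tr x"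
  by (simp add: emb_tr partial_trace_emb_mult emb_mult flip: emb_eq_iff)

lemma tr_0 [simp]: "tr 0 = 0"
  using tr_emb_mult[of 0 0] by simp

lemma tr_uminus: "tr (- x) = - tr x"
  using tr_add[of x "- x"] by (simp add: eq_neg_iff_add_eq_0 add.commute)

lemma tr_diff: "tr (x - y) = tr x - tr y"
  using tr_add[of x "- y"] by (simp add: tr_uminus)

lemma card_tr_fibre: "card {x. tr x = c} = p ^ (m - 1)"
proof -
  have "{x. tr x = c} = {x \<in> fixed_field m. partial_trace m x = emb c}"
    by (simp add: fixed_field_m flip: emb_tr)
  then show ?thesis
    using card_partial_trace_fibre[of m c] m_pos by (simp add: fixed_field_m card_k)
qed

lemma card_tr_mult_fibre:
  assumes "a \<noteq> 0"
  shows "card {x. tr (a * x) = c} = p ^ (m - 1)"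
proof -
  have "bij_betw ((*) a) {x. tr (a * x) = c} {x. tr x = c}"
    by (rule bij_betw_byWitness[where f' = "\<lambda>y. y / a"]) (use assms in auto)
  from bij_betw_same_card[OF this] show ?thesis by (simp add: card_tr_fibre)
qed

section \<open>The quadratic form \<open>tr (x\<^sup>2)\<close>\<close>

text \<open>The function V of the overview.\<close>

definition sq_count :: "'p mod_ring \<Rightarrow> nat" where
  "sq_count u = card {x::'k. tr (x\<^sup>2) = u}"

text \<open>Zero is counted here although it is not in D; it is subtracted when codewords are
  examined.\<close>

definition sq_count_orth :: "'k \<Rightarrow> nat" where
  "sq_count_orth a = card {x. tr (x\<^sup>2) = 0 \<and> tr (a * x) = 0}"

lemma tr_square_add:
  "tr ((x + emb t * a)\<^sup>2) = tr (x\<^sup>2) + 2 * t * tr (a * x) + t\<^sup>2 * tr (a\<^sup>2)"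
proof -
  have "(x + emb t * a)\<^sup>2 = x\<^sup>2 + emb (2 * t) * (a * x) + emb (t\<^sup>2) * a\<^sup>2"
    using emb_add[of 1 1] by (simp add: power2_eq_square emb_mult algebra_simps)
  then show ?thesis by (simp add: tr_add tr_emb_mult)
qed

lemma tr_mult_add: "tr (a * (x + emb t * y)) = tr (a * x) + t * tr (a * y)"
  using tr_add[of "a * x" "emb t * (a * y)"] tr_emb_mult[of t "a * y"] by (simp add: algebra_simps)

text \<open>Multiplying \<open>x\<close> by \<open>emb t\<close> multiplies the form by the square
  of \<open>t\<close>. Hence on nonzero values the count depends only on the square class.\<close>

lemma sq_count_scale:
  assumes "t \<noteq> 0"
  shows "sq_count (t\<^sup>2 * u) = sq_count u"
proof -
  have "tr ((emb t * x)\<^sup>2) = t\<^sup>2 * tr (x\<^sup>2)" for x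
    using tr_emb_mult[of "t\<^sup>2" "x\<^sup>2"] by (simp add: power_mult_distrib emb_power)
  moreover have "x = emb t * (x / emb t)" for x using assms by simp
  ultimately have "tr ((x / emb t)\<^sup>2) = tr (x\<^sup>2) / t\<^sup>2" for x
    using assms by (metis nonzero_mult_div_cancel_left power_not_zero)
  with \<open>\<And>x. tr ((emb t * x)\<^sup>2) = t\<^sup>2 * tr (x\<^sup>2)\<close>
  have "bij_betw ((*) (emb t)) {x. tr (x\<^sup>2) = u} {x. tr (x\<^sup>2) = t\<^sup>2 * u}"
    by (intro bij_betw_byWitness[where f' = "\<lambda>y. y / emb t"]) (use assms in auto)
  from bij_betw_same_card[OF this] show ?thesis by (simp add: sq_count_def)
qed

text \<open>Scaling by \<open>emb v\<close> preserves isotropy and multiplies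
  \<open>tr (a * x)\<close> by \<open>v\<close>. This is why a codeword has only two distinct symbol
  multiplicities.\<close>

lemma card_sq_orth_scale:
  assumes "v \<noteq> 0"
  shows "card {x. tr (x\<^sup>2) = 0 \<and> tr (a * x) = v} = card {x. tr (x\<^sup>2) = 0 \<and> tr (a * x) = 1}"
proof -
  have *: "tr ((emb t * x)\<^sup>2) = t\<^sup>2 * tr (x\<^sup>2)" "tr (a * (emb t * x)) = t * tr (a * x)" for x t
    using tr_emb_mult[of "t\<^sup>2" "x\<^sup>2"] tr_emb_mult[of t "a * x"]
    by (simp_all add: power_mult_distrib emb_power algebra_simps)
  have inv: "emb v * emb (inverse v) = 1" "emb (inverse v) * emb v = 1"
    using assms by (simp_all flip: emb_mult)
  have **: "emb v * (emb (inverse v) * x) = x" "emb (inverse v) * (emb v * x) = x" for x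
    by (simp_all only: mult.assoc[symmetric] inv mult_1)
  have "bij_betw ((*) (emb v)) {x. tr (x\<^sup>2) = 0 \<and> tr (a * x) = 1} {x. tr (x\<^sup>2) = 0 \<and> tr (a * x) = v}"
    by (rule bij_betw_byWitness[where f' = "(*) (emb (inverse v))"])
      (use assms in \<open>auto simp: * **\<close>)
  from bij_betw_same_card[OF this] show ?thesis by simp
qed

lemma sum_card_fibre: "(\<Sum>u\<in>UNIV. card {x::'k. Q x \<and> f x = u}) = card {x. Q x}"
  for f :: "'k \<Rightarrow> 'p mod_ring"
  using sum_fun_comp[of "{x. Q x}" UNIV f "\<lambda>_. 1::nat"] by simp

text \<open>Ties the two multiplicities together: once V 0 is known, either one determines the
  other.\<close>

lemma sq_count_0_split:
  "sq_count 0 = sq_count_orth a + (p - 1) * card {x. tr (x\<^sup>2) = 0 \<and> tr (a * x) = 1}"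
proof -
  have "sq_count 0 = (\<Sum>v\<in>UNIV. card {x. tr (x\<^sup>2) = 0 \<and> tr (a * x) = v})"
    using sum_card_fibre[of "\<lambda>x. tr (x\<^sup>2) = 0" "\<lambda>x. tr (a * x)"] by (simp add: sq_count_def)
  also have "\<dots> = sq_count_orth a + (\<Sum>v\<in>UNIV - {0}. card {x. tr (x\<^sup>2) = 0 \<and> tr (a * x) = v})"
    by (subst sum.remove[of _ 0]) (auto simp: sq_count_orth_def)
  also have "(\<Sum>v\<in>UNIV - {0}. card {x. tr (x\<^sup>2) = 0 \<and> tr (a * x) = v})
      = (\<Sum>v\<in>UNIV - {0::'p mod_ring}. card {x. tr (x\<^sup>2) = 0 \<and> tr (a * x) = 1})"
    by (rule sum.cong[OF refl card_sq_orth_scale]) auto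
  finally show ?thesis by (simp add: card_Diff_subset card_p)
qed

text \<open>Translation by multiples of an isotropic \<open>a\<close> fixes \<open>tr (a * x)\<close> and, if that is nonzero,
  shifts \<open>tr (x\<^sup>2)\<close> through all values.\<close>

lemma card_sq_orth_isotropic:
  assumes "a \<noteq> 0" "tr (a\<^sup>2) = 0" "m \<ge> 2"
  shows "card {x. tr (x\<^sup>2) = 0 \<and> tr (a * x) = 1} = p ^ (m - 2)"
proof -
  have "card {x. tr (a * x) = 1 \<and> tr (x\<^sup>2) = u} = card {x. tr (a * x) = 1 \<and> tr (x\<^sup>2) = 0}" for u
  proof -
    have *: "tr ((x + emb t * a)\<^sup>2) = tr (x\<^sup>2) + 2 * t" "tr (a * (x + emb t * a)) = 1"
      if "tr (a * x) = 1" for x t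
      using that assms(2) by (simp_all add: tr_square_add tr_mult_add flip: power2_eq_square)
    \<comment> \<open>Translation by \<open>emb t * a\<close> shifts the form by
      \<open>2 * t\<close>, so \<open>t = u / 2\<close> carries the value 0 to
      \<open>u\<close>.\<close>
    have "2 * (u / 2) = u" using two_F by simp
    then have half: "2 * - (u / 2) = - u" by (simp only: mult_minus_right)
    have canc: "x + emb c * a + emb (- c) * a = x" "x + emb (- c) * a + emb c * a = x" for x c
      by (simp_all add: emb_uminus)
    have "bij_betw (\<lambda>x. x + emb (u / 2) * a) {x. tr (a * x) = 1 \<and> tr (x\<^sup>2) = 0}
        {x. tr (a * x) = 1 \<and> tr (x\<^sup>2) = u}"
      by (rule bij_betw_byWitness[where f' = "\<lambda>x. x + emb (- (u / 2)) * a"])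
        (auto simp only: * \<open>2 * (u / 2) = u\<close> half canc, simp_all add: two_F)
    from bij_betw_same_card[OF this] show ?thesis by simp
  qed
  then have "(\<Sum>u\<in>UNIV. card {x. tr (a * x) = 1 \<and> tr (x\<^sup>2) = u})
      = (\<Sum>u\<in>(UNIV::'p mod_ring set). card {x. tr (a * x) = 1 \<and> tr (x\<^sup>2) = 0})"
    by (rule sum.cong[OF refl])
  then have "p * card {x. tr (a * x) = 1 \<and> tr (x\<^sup>2) = 0} = p ^ (m - 1)"
    using sum_card_fibre[of "\<lambda>x. tr (a * x) = 1" "\<lambda>x. tr (x\<^sup>2)"] card_tr_mult_fibre[OF assms(1), of 1]
    by (simp add: card_p)
  moreover have "p ^ (m - 1) = p * p ^ (m - 2)"
  proof -
    have "m - 1 = Suc (m - 2)" using assms(3) by simp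
    then show ?thesis by (simp only: power_Suc)
  qed
  ultimately show ?thesis using p_ge_3 by (simp add: conj_commute)
qed

text \<open>Both sides count the pairs \<open>(r, x)\<close> with \<open>tr (x\<^sup>2) = A r\<^sup>2\<close>: with \<open>x = z + t a\<close> and
  \<open>z\<close> orthogonal to \<open>a\<close>, the condition reads \<open>tr (z\<^sup>2) = A (r - t) (r + t)\<close>.\<close>

lemma sq_count_orth_anisotropic:
  assumes A: "tr (a\<^sup>2) \<noteq> 0"
  shows "p * sq_count_orth a + (p - 1) * p ^ (m - 1) = sq_count 0 + (p - 1) * sq_count (tr (a\<^sup>2))"
proof -
  define A where "A = tr (a\<^sup>2)"
  have A0 [simp]: "A \<noteq> 0" using A by (simp add: A_def)
  have "a \<noteq> 0" using A by auto
  define L where "L = Sigma (UNIV::'p mod_ring set) (\<lambda>r. {x. tr (x\<^sup>2) = A * r\<^sup>2})"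
  define R where "R = Sigma (UNIV::'p mod_ring set)
    (\<lambda>g. Sigma (UNIV::'p mod_ring set) (\<lambda>h. {z. tr (a * z) = 0 \<and> tr (z\<^sup>2) = A * g * h}))"
  \<comment> \<open>The coefficient of \<open>a\<close> in the orthogonal splitting of
    \<open>x\<close>, available because \<open>A\<close> is nonzero.\<close>
  define t where "t x = tr (a * x) / A" for x
  have t1: "t (z + emb c * a) = c" if "tr (a * z) = 0" for z c
    using that A by (simp add: t_def tr_mult_add A_def flip: power2_eq_square)
  have orth: "tr (a * (x + emb (- t x) * a)) = 0" for x
    by (simp only: tr_mult_add) (use A in \<open>simp add: t_def A_def flip: power2_eq_square\<close>)
  have nrm: "tr ((x + emb (- t x) * a)\<^sup>2) = tr (x\<^sup>2) - A * (t x)\<^sup>2" for x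
  proof -
    have "tr (a * x) = A * t x" by (simp add: t_def)
    then show ?thesis by (simp only: tr_square_add A_def[symmetric]) (simp add: power2_eq_square)
  qed
  have nrm': "tr ((z + emb c * a)\<^sup>2) = tr (z\<^sup>2) + A * c\<^sup>2" if "tr (a * z) = 0" for z c
    using that by (simp add: tr_square_add A_def)
  note half = half_sum_diff(1,2)[OF two_F] and half' = half_sum_diff(3,4)[OF two_F]
  have sq: "((g + h) / 2)\<^sup>2 = g * h + ((h - g) / 2)\<^sup>2" for g h :: "'p mod_ring"
  proof -
    have "((g + h) / 2)\<^sup>2 - ((h - g) / 2)\<^sup>2 = g * h"
      using square_diff_square_factored[of "(g + h) / 2" "(h - g) / 2"] half
      by (simp add: power2_eq_square)
    then show ?thesis by (simp add: algebra_simps)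
  qed
  have "bij_betw (\<lambda>(r, x). (r - t x, r + t x, x + emb (- t x) * a)) L R"
  \<comment> \<open>With \<open>g = r - t\<close> and \<open>h = r + t\<close>, the half sum returns
    \<open>r\<close> and the half difference returns the coefficient of \<open>a\<close>.\<close>
  proof (rule bij_betw_byWitness[where f' = "\<lambda>(g, h, z). ((g + h) / 2, z + emb ((h - g) / 2) * a)"])
    show "\<forall>c\<in>L. (\<lambda>(g, h, z). ((g + h) / 2, z + emb ((h - g) / 2) * a))
        ((\<lambda>(r, x). (r - t x, r + t x, x + emb (- t x) * a)) c) = c"
    proof (clarify, goal_cases)
      case (1 r x)
      have "((r + t x) - (r - t x)) / 2 = t x" by (rule half')
      then show ?case by (simp only: half' prod.case) (simp add: emb_uminus)
    qed
    show "\<forall>c\<in>R. (\<lambda>(r, x). (r - t x, r + t x, x + emb (- t x) * a))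
        ((\<lambda>(g, h, z). ((g + h) / 2, z + emb ((h - g) / 2) * a)) c) = c"
    proof (clarify, goal_cases)
      case (1 g h z)
      then have "t (z + emb ((h - g) / 2) * a) = (h - g) / 2" by (simp add: R_def t1)
      then show ?case by (simp only: half prod.case) (simp add: emb_uminus)
    qed
    show "(\<lambda>(r, x). (r - t x, r + t x, x + emb (- t x) * a)) ` L \<subseteq> R"
    proof (rule image_subsetI)
      fix c assume "c \<in> L"
      then obtain r x where c: "c = (r, x)" "(r, x) \<in> L" by (cases c) auto
      then have "tr (x\<^sup>2) = A * r\<^sup>2" by (simp add: L_def)
      then have "tr ((x + emb (- t x) * a)\<^sup>2) = A * (r - t x) * (r + t x)"
        unfolding nrm by (simp add: power2_eq_square algebra_simps)
      then show "(case c of (r, x) \<Rightarrow> (r - t x, r + t x, x + emb (- t x) * a)) \<in> R"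
        using orth[of x] by (simp add: R_def c(1))
    qed
    show "(\<lambda>(g, h, z). ((g + h) / 2, z + emb ((h - g) / 2) * a)) ` R \<subseteq> L"
    proof (rule image_subsetI)
      fix c assume "c \<in> R"
      then obtain g h z where c: "c = (g, h, z)" "(g, h, z) \<in> R" by (cases c) auto
      then have "tr (a * z) = 0" "tr (z\<^sup>2) = A * g * h" by (simp_all add: R_def)
      then have "tr ((z + emb ((h - g) / 2) * a)\<^sup>2) = A * ((g + h) / 2)\<^sup>2"
        unfolding sq by (simp only: nrm') (simp add: algebra_simps)
      then show "(case c of (g, h, z) \<Rightarrow> ((g + h) / 2, z + emb ((h - g) / 2) * a)) \<in> L"
        by (simp add: L_def c(1))
    qed
  qed
  then have "card L = card R" by (rule bij_betw_same_card)
  moreover have "card L = sq_count 0 + (p - 1) * sq_count A"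
  proof -
    have "card L = (\<Sum>r\<in>UNIV. sq_count (A * r\<^sup>2))" by (simp add: L_def sq_count_def)
    also have "\<dots> = sq_count 0 + (\<Sum>r\<in>UNIV - {0}. sq_count (A * r\<^sup>2))"
      by (subst sum.remove[of _ 0]) auto
    also have "(\<Sum>r\<in>UNIV - {0}. sq_count (A * r\<^sup>2)) = (\<Sum>r\<in>UNIV - {0::'p mod_ring}. sq_count A)"
      by (rule sum.cong) (auto simp: mult.commute[of A] sq_count_scale)
    finally show ?thesis by (simp add: card_Diff_subset card_p)
  qed
  moreover have "card R = p * sq_count_orth a + (p - 1) * p ^ (m - 1)"
  proof -
    \<comment> \<open>For \<open>g = 0\<close> each \<open>h\<close> gives the wanted count. For
      \<open>g\<close> nonzero, \<open>A * g * h\<close> runs through all of F_p, so the sum is the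
      size of the whole hyperplane.\<close>
    define N where "N g = (\<Sum>h\<in>UNIV. card {z. tr (a * z) = 0 \<and> tr (z\<^sup>2) = A * g * h})" for g
    have "N 0 = p * sq_count_orth a"
      by (simp add: N_def sq_count_orth_def conj_commute card_p)
    moreover have "N g = p ^ (m - 1)" if "g \<noteq> 0" for g
    proof -
      have "N g = (\<Sum>h\<in>UNIV. card {z. tr (a * z) = 0 \<and> tr (z\<^sup>2) = h})"
        unfolding N_def
        by (rule sum.reindex_bij_betw[of "\<lambda>h. A * g * h"],
            rule bij_betw_byWitness[where f' = "\<lambda>h. h / (A * g)"]) (use that in auto)
      then show ?thesis
        using sum_card_fibre[of "\<lambda>z. tr (a * z) = 0" "\<lambda>z. tr (z\<^sup>2)"] card_tr_mult_fibre[OF \<open>a \<noteq> 0\<close>, of 0]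
        by simp
    qed
    moreover have "card R = (\<Sum>g\<in>UNIV. N g)" by (simp add: R_def N_def)
    moreover have "(\<Sum>g\<in>UNIV. N g) = N 0 + (\<Sum>g\<in>UNIV - {0}. N g)"
      by (rule sum.remove) auto
    ultimately show ?thesis by (simp add: card_Diff_subset card_p)
  qed
  ultimately show ?thesis by (simp add: A_def)
qed

section \<open>First and second moment of the value counts\<close>

lemma sum_sq_count: "(\<Sum>u\<in>UNIV. sq_count u) = p ^ m"
  using sum_card_fibre[of "\<lambda>_. True" "\<lambda>x. tr (x\<^sup>2)"] card_k by (simp add: sq_count_def)

text \<open>The sum counts the pairs with \<open>tr (x\<^sup>2 - y\<^sup>2) = 0\<close>; factor the difference.\<close>

lemma sum_sq_count_squared: "(\<Sum>u\<in>UNIV. (sq_count u)\<^sup>2) = p ^ m + (p ^ m - 1) * p ^ (m - 1)"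
proof -
  define L where "L = Sigma (UNIV::'p mod_ring set) (\<lambda>u. {x::'k. tr (x\<^sup>2) = u} \<times> {y. tr (y\<^sup>2) = u})"
  define R where "R = Sigma (UNIV::'k set) (\<lambda>s. {t. tr (s * t) = 0})"
  have tr_eq: "tr (x\<^sup>2) = tr (y\<^sup>2) \<longleftrightarrow> tr ((x - y) * (x + y)) = 0" for x y
  proof -
    have "(x - y) * (x + y) = x\<^sup>2 - y\<^sup>2"
      by (simp add: power2_eq_square algebra_simps)
    then show ?thesis by (simp add: tr_diff)
  qed
  note half = half_sum_diff(1,2)[OF two_k] and half' = half_sum_diff(3,4)[OF two_k]
  have "bij_betw (\<lambda>(u, x, y). (x - y, x + y)) L R"
  proof (rule bij_betw_byWitness[where f' = "\<lambda>(s, t). (tr (((s + t) / 2)\<^sup>2), (s + t) / 2, (t - s) / 2)"])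
    show "\<forall>c\<in>L. (\<lambda>(s, t). (tr (((s + t) / 2)\<^sup>2), (s + t) / 2, (t - s) / 2))
        ((\<lambda>(u, x, y). (x - y, x + y)) c) = c"
    proof (clarify, goal_cases)
      case (1 u x y)
      then show ?case by (simp only: half' prod.case) (simp add: L_def)
    qed
    show "\<forall>c\<in>R. (\<lambda>(u, x, y). (x - y, x + y))
        ((\<lambda>(s, t). (tr (((s + t) / 2)\<^sup>2), (s + t) / 2, (t - s) / 2)) c) = c"
    proof (clarify, goal_cases)
      case (1 s t)
      then show ?case by (simp only: half prod.case)
    qed
    show "(\<lambda>(u, x, y). (x - y, x + y)) ` L \<subseteq> R"
    proof (rule image_subsetI)
      fix c assume "c \<in> L"
      then obtain u x y where c: "c = (u, x, y)" "(u, x, y) \<in> L" by (cases c) auto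
      then have "tr (x\<^sup>2) = tr (y\<^sup>2)" by (simp add: L_def)
      then show "(case c of (u, x, y) \<Rightarrow> (x - y, x + y)) \<in> R"
        unfolding tr_eq by (simp add: R_def c(1))
    qed
    show "(\<lambda>(s, t). (tr (((s + t) / 2)\<^sup>2), (s + t) / 2, (t - s) / 2)) ` R \<subseteq> L"
    proof (rule image_subsetI)
      fix c assume "c \<in> R"
      then obtain s t where c: "c = (s, t)" "(s, t) \<in> R" by (cases c) auto
      then have "tr (((s + t) / 2)\<^sup>2) = tr (((t - s) / 2)\<^sup>2)"
        unfolding tr_eq half by (simp add: R_def)
      then show "(case c of (s, t) \<Rightarrow> (tr (((s + t) / 2)\<^sup>2), (s + t) / 2, (t - s) / 2)) \<in> L"
        by (simp add: L_def c(1))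
    qed
  qed
  then have "card L = card R" by (rule bij_betw_same_card)
  moreover have "card L = (\<Sum>u\<in>UNIV. (sq_count u)\<^sup>2)"
    by (simp add: L_def sq_count_def card_cartesian_product power2_eq_square)
  moreover have "card R = p ^ m + (p ^ m - 1) * p ^ (m - 1)"
  proof -
    have "card R = (\<Sum>s\<in>UNIV. card {t. tr (s * t) = 0})" by (simp add: R_def)
    also have "\<dots> = p ^ m + (\<Sum>s\<in>UNIV - {0}. card {t. tr (s * t) = 0})"
      by (subst sum.remove[of _ 0]) (auto simp: card_k)
    also have "(\<Sum>s\<in>UNIV - {0}. card {t. tr (s * t) = 0}) = (\<Sum>s\<in>UNIV - {0::'k}. p ^ (m - 1))"
      by (rule sum.cong[OF refl card_tr_mult_fibre]) auto
    finally show ?thesis by (simp add: card_Diff_subset card_k)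
  qed
  ultimately show ?thesis by simp
qed

text \<open>Each nonzero square is hit by two elements \<open>x\<close>; the summand 1 is
  \<open>x = 0\<close>, which has value 0.\<close>

lemma sq_count_eq_squares:
  "sq_count u = 2 * card {s. s \<noteq> 0 \<and> (\<exists>x. s = x\<^sup>2) \<and> tr s = u} + (if u = 0 then 1 else 0)"
proof -
  have "{x::'k. tr (x\<^sup>2) = u} = (if u = 0 then insert 0 else id) {x. x \<noteq> 0 \<and> tr (x\<^sup>2) = u}"
    by auto
  then have "sq_count u = card {x::'k. x \<noteq> 0 \<and> tr (x\<^sup>2) = u} + (if u = 0 then 1 else 0)"
    by (simp add: sq_count_def)
  then show ?thesis
    using card_eq_of_squares[OF two_k, of "\<lambda>s. tr s = u"] by simp
qed

section \<open>Value counts for odd m\<close>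

lemma emb_square_odd:
  assumes "odd m" "emb y = z\<^sup>2"
  shows "\<exists>t. y = t\<^sup>2"
proof (cases "z = 0")
  case False
  \<comment> \<open>The square of \<open>z\<close> is fixed by Frobenius, so Frobenius maps
    \<open>z\<close> to \<open>z\<close> or \<open>- z\<close>. In the first case \<open>z\<close>
    lies in F_p.\<close>
  have "(z ^ p)\<^sup>2 = emb y ^ p" by (simp add: assms(2) mult.commute flip: power_mult)
  then have "(z ^ p)\<^sup>2 = z\<^sup>2" using emb_fixed[of y] assms(2) by simp
  then consider "z ^ p = z" | "z ^ p = - z" by (auto simp: power2_eq_iff)
  then show ?thesis
  proof cases
    case 1
    then obtain t where "z = emb t" using range_emb by auto
    then have "emb y = emb (t\<^sup>2)" by (simp add: assms(2) emb_power)
    then show ?thesis by auto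
  next
    case 2
    \<comment> \<open>After \<open>m\<close> steps Frobenius is the identity while the sign is
      \<open>(-1) ^ m = -1\<close>, which excludes this case.\<close>
    have "z ^ (p ^ i) = (-1) ^ i * z" for i
    proof (induction i)
      case (Suc i)
      have "z ^ (p ^ Suc i) = (z ^ (p ^ i)) ^ p" by (simp add: mult.commute flip: power_mult)
      also have "\<dots> = ((-1) ^ i) ^ p * z ^ p" by (simp only: Suc.IH power_mult_distrib)
      also have "((-1) ^ i) ^ p = ((-1) ^ i :: 'k)"
        using odd_p by (simp add: minus_one_power_iff)
      finally show ?case using 2 by simp
    qed simp
    from this[of m] have "z = - z" using frobenius_m[of z] \<open>odd m\<close> by simp
    then have "2 * z = 0" by (simp only: mult_2 eq_neg_iff_add_eq_0)
    then show ?thesis using two_k False by simp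
  qed
qed (use assms in auto)

text \<open>Since \<open>emb y\<close> stays a nonsquare, multiplication by it carries the nonzero
  squares of trace \<open>u\<close> onto the nonzero nonsquares of trace \<open>y * u\<close>.
  Together with the squares of trace \<open>y * u\<close> these fill a whole trace fibre, and each
  element is counted twice.\<close>

lemma sq_count_nonsquare:
  assumes "odd m" "\<nexists>t. y = t\<^sup>2"
  shows "sq_count u + sq_count (y * u) = 2 * p ^ (m - 1)"
proof -
  have y: "emb y \<noteq> 0" "y \<noteq> 0" "\<nexists>z. emb y = z\<^sup>2"
    using assms(2) emb_square_odd[OF assms(1)] by auto
  let ?S = "{s. s \<noteq> 0 \<and> (\<exists>x. s = x\<^sup>2) \<and> tr s = y * u}"
  let ?N = "{s. s \<noteq> 0 \<and> (\<nexists>x. s = x\<^sup>2) \<and> tr s = y * u}"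
  have emb_inv: "emb y * emb (inverse y) = 1" using y by (simp flip: emb_mult)
  then have emb_inv': "emb (inverse y) * emb y = 1" by (simp only: mult.commute)
  have "bij_betw ((*) (emb y)) {s. s \<noteq> 0 \<and> (\<exists>x. s = x\<^sup>2) \<and> tr s = u} ?N"
  proof (rule bij_betw_byWitness[where f' = "(*) (emb (inverse y))"])
    show "(*) (emb y) ` {s. s \<noteq> 0 \<and> (\<exists>x. s = x\<^sup>2) \<and> tr s = u} \<subseteq> ?N"
      using finite_field_nonsquare_mult[OF two_k _ y(1,3)] y by (auto simp: tr_emb_mult)
    have "(\<exists>x. emb (inverse y) * s = x\<^sup>2)" if "s \<noteq> 0" "\<nexists>x. s = x\<^sup>2" for s
    proof -
      have "emb y * (emb (inverse y) * s) = s" by (simp add: emb_inv flip: mult.assoc)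
      moreover have "emb (inverse y) * s \<noteq> 0" using that y by simp
      ultimately show ?thesis
        using finite_field_nonsquare_mult[OF two_k _ y(1,3)] that(2) by metis
    qed
    then show "(*) (emb (inverse y)) ` ?N \<subseteq> {s. s \<noteq> 0 \<and> (\<exists>x. s = x\<^sup>2) \<and> tr s = u}"
      using y by (auto simp: tr_emb_mult)
  qed (simp_all only: mult.assoc[symmetric] emb_inv emb_inv' mult_1, simp_all)
  from bij_betw_same_card[OF this]
  have "sq_count u + sq_count (y * u) = 2 * (card ?N + card ?S) + (if u = 0 then 2 else 0)"
    using sq_count_eq_squares[of u] sq_count_eq_squares[of "y * u"] y by simp
  also have "card ?N + card ?S = card {s. s \<noteq> 0 \<and> tr s = y * u}"
    by (subst card_Un_disjoint[symmetric]) (auto intro: arg_cong[where f = card])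
  \<comment> \<open>For \<open>u = 0\<close> both counts contributed the root 0 once; these two
    units account for \<open>s = 0\<close>, which completes the fibre.\<close>
  also have "2 * card {s. s \<noteq> 0 \<and> tr s = y * u} + (if u = 0 then 2 else 0)
      = 2 * card {s. tr s = y * u}"
  proof -
    have "{s. tr s = y * u} = (if u = 0 then insert 0 else id) {s. s \<noteq> 0 \<and> tr s = y * u}"
      using y by auto
    then have "card {s. tr s = y * u} = card {s. s \<noteq> 0 \<and> tr s = y * u} + (if u = 0 then 1 else 0)"
      by simp
    then show ?thesis by simp
  qed
  finally show ?thesis by (simp add: card_tr_fibre)
qed

lemma ex_nonsquare: "\<exists>y::'p mod_ring. \<nexists>t. y = t\<^sup>2"
proof (rule ccontr)
  assume "\<not> ?thesis"
  then have "{s::'p mod_ring. s \<noteq> 0 \<and> (\<exists>x. s = x\<^sup>2)} = UNIV - {0}" by auto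
  then show False
    using card_nonzero_squares[OF two_F] p_ge_3 card_p by (simp add: card_Diff_subset)
qed

text \<open>The value 0 is paired with itself, so it takes exactly the mean.\<close>

lemma sq_count_0_odd:
  assumes "odd m"
  shows "sq_count 0 = p ^ (m - 1)"
proof -
  obtain y :: "'p mod_ring" where "\<nexists>t. y = t\<^sup>2" using ex_nonsquare by auto
  from sq_count_nonsquare[OF assms this, of 0] show ?thesis by simp
qed

text \<open>Deviation from the mean of V over the \<open>p\<close> values; integers because its sign
  matters.\<close>

definition sq_defect :: "'p mod_ring \<Rightarrow> int" where
  "sq_defect u = int (sq_count u) - int (p ^ (m - 1))"

lemma sum_sq_defect: "(\<Sum>u\<in>UNIV. sq_defect u) = 0"
proof -
  have "int (p ^ m) = int p * int (p ^ (m - 1))"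
    using m_pos by (cases m) simp_all
  moreover have "(\<Sum>u\<in>UNIV. int (sq_count u)) = int (p ^ m)"
    unfolding sum_sq_count[symmetric] by simp
  ultimately show ?thesis by (simp add: sq_defect_def sum_subtractf card_p)
qed

text \<open>The squared deviation is the same at all nonzero values: scaling handles one square
  class, and the pairing through a nonsquare negates the deviation across classes. It vanishes at 0,
  so the variance is \<open>p - 1\<close> equal terms and the second moment fixes each of
  them.\<close>

lemma sq_defect_squared_odd:
  assumes "odd m" "u \<noteq> 0"
  shows "(sq_defect u)\<^sup>2 = int p ^ (m - 1)"
proof -
  have const: "(sq_defect v)\<^sup>2 = (sq_defect u)\<^sup>2" if "v \<noteq> 0" for v
  proof (cases "\<exists>t. v / u = t\<^sup>2")
    case True
    then obtain t where t: "v / u = t\<^sup>2" by auto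
    then have "t \<noteq> 0" "v = t\<^sup>2 * u" using that assms(2) by (auto simp: field_simps)
    then show ?thesis using sq_count_scale by (simp add: sq_defect_def)
  next
    case False
    from sq_count_nonsquare[OF assms(1) False, of u] assms(2)
    have "sq_count u + sq_count v = 2 * p ^ (m - 1)" by simp
    then have "int (sq_count u) + int (sq_count v) = 2 * int (p ^ (m - 1))"
      by (metis of_nat_add of_nat_mult of_nat_numeral)
    then have "sq_defect v = - sq_defect u" by (simp add: sq_defect_def)
    then show ?thesis by simp
  qed
  have d0: "sq_defect 0 = 0" using sq_count_0_odd[OF assms(1)] by (simp add: sq_defect_def)
  define P where "P = int p ^ (m - 1)"
  have pm: "int p ^ m = int p * P" unfolding P_def using m_pos by (cases m) simp_all
  have "(\<Sum>v\<in>UNIV. (sq_defect v)\<^sup>2) = (\<Sum>v\<in>UNIV - {0}. (sq_defect v)\<^sup>2)"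
    by (subst sum.remove[of _ 0]) (auto simp: d0)
  also have "\<dots> = (\<Sum>v\<in>UNIV - {0::'p mod_ring}. (sq_defect u)\<^sup>2)"
    by (rule sum.cong[OF refl const]) auto
  also have "\<dots> = (int p - 1) * (sq_defect u)\<^sup>2"
    using p_ge_3 by (simp add: card_Diff_subset card_p of_nat_diff)
  finally have 1: "(\<Sum>v\<in>UNIV. (sq_defect v)\<^sup>2) = (int p - 1) * (sq_defect u)\<^sup>2" .
  have "int (\<Sum>v\<in>UNIV. (sq_count v)\<^sup>2) = int p ^ m + (int p ^ m - 1) * P"
    unfolding sum_sq_count_squared P_def using p_ge_3 by (simp add: of_nat_diff)
  then have "int (\<Sum>v\<in>UNIV. (sq_count v)\<^sup>2) = int p * P + (int p * P - 1) * P"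
    unfolding pm .
  \<comment> \<open>Expand V as mean plus deviation; the cross term drops out because the deviations
    sum to zero.\<close>
  moreover have "int (\<Sum>v\<in>UNIV. (sq_count v)\<^sup>2)
      = (\<Sum>v\<in>UNIV. (sq_defect v)\<^sup>2 + 2 * P * sq_defect v + P\<^sup>2)"
    by (simp add: sq_defect_def P_def power2_eq_square algebra_simps)
  moreover have "\<dots> = (\<Sum>v\<in>UNIV. (sq_defect v)\<^sup>2) + int p * P\<^sup>2"
    using sum_sq_defect by (simp add: sum.distrib card_p flip: sum_distrib_left)
  ultimately have "(int p - 1) * (sq_defect u)\<^sup>2 = (int p - 1) * P"
    using 1 by (simp add: power2_eq_square algebra_simps)
  then show ?thesis using p_ge_3 by (simp add: P_def)
qed

section \<open>Value counts for even m, through the subfield of index two\<close>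

lemma card_k_double: "m = 2 * h \<Longrightarrow> CARD('k) = p ^ h * p ^ h"
  by (simp add: card_k mult_2 power_add)

lemma zero_fixed: "0 \<in> fixed_field h"
  using p_ge_3 by (simp add: fixed_field_def power_0_left)

text \<open>For \<open>m = 2 * h\<close> this is the kernel of the relative trace to the subfield,
  the line on which that trace vanishes.\<close>

definition skew_field_part :: "nat \<Rightarrow> 'k set" where
  "skew_field_part h = {x. x ^ (p ^ h) = - x}"

text \<open>With \<open>q = p ^ h\<close>, the relative trace \<open>T\<close> maps the field into
  \<open>fixed_field h\<close>. Degree bounds give at most \<open>q\<close> fixed elements and at
  most \<open>q\<close> elements per fibre of \<open>T\<close>, while the field has
  \<open>q * q\<close>; so both bounds are attained, in particular by the kernel.\<close>

lemma card_fixed_and_skew: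
  assumes "m = 2 * h"
  shows "card (fixed_field h) = p ^ h" "card (skew_field_part h) = p ^ h"
proof -
  define q where "q = p ^ h"
  have "h > 0" using assms m_pos by simp
  then have "q > 1" using p_ge_3 by (simp add: q_def one_less_power del: One_nat_def)
  have qq: "CARD('k) = q * q" using card_k_double[OF assms] by (simp add: q_def)
  define T where "T x = x ^ q + x" for x :: 'k
  have frob: "(x ^ q) ^ q = x" for x :: 'k
    using frobenius_m[of x] assms by (simp add: q_def mult_2 power_add power_mult)
  have T_fixed: "T x \<in> fixed_field h" for x
    using frob[of x] by (simp add: T_def fixed_field_def q_def frobenius_add add.commute)
  have fib: "card {x. T x = b} \<le> q" for b
  proof -
    have "degree (monom (1::'k) q + monom 1 1) = q"
      using degree_add_eq_left[of "monom (1::'k) 1" "monom 1 q"] \<open>q > 1\<close>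
      by (simp add: degree_monom_eq)
    from card_poly_fibre_le[OF this, of b] show ?thesis
      using \<open>q > 1\<close> by (simp add: T_def poly_monom)
  qed
  have "degree (monom (1::'k) q - monom 1 1) = q"
    using degree_add_eq_left[of "- monom (1::'k) 1" "monom 1 q"] \<open>q > 1\<close>
    by (simp add: degree_monom_eq)
  from card_poly_fibre_le[OF this, of 0] have "card (fixed_field h) \<le> q"
    using p_ge_3 by (simp add: fixed_field_def q_def poly_monom)
  moreover have "q * q \<le> card (fixed_field h) * q"
  proof -
    have "CARD('k) = (\<Sum>b\<in>fixed_field h. card {x \<in> UNIV. T x = b})"
      using sum_fun_comp[of UNIV "fixed_field h" T "\<lambda>_. 1::nat"] T_fixed by auto
    also have "\<dots> \<le> card (fixed_field h) * q"
      using sum_bounded_above[of "fixed_field h" "\<lambda>b. card {x. T x = b}" q] fib by simp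
    finally show ?thesis by (simp add: qq)
  qed
  ultimately have F: "card (fixed_field h) = q" using \<open>q > 1\<close> by simp
  then show "card (fixed_field h) = p ^ h" by (simp add: q_def)
  have "card {x \<in> UNIV. T x = 0} = q"
    by (rule card_fibre_eq_of_le[where B = "fixed_field h"])
      (use T_fixed fib F qq p_ge_3 in \<open>auto simp: fixed_field_def q_def\<close>)
  then show "card (skew_field_part h) = p ^ h"
    by (simp add: T_def skew_field_part_def q_def eq_neg_iff_add_eq_0)
qed

text \<open>Transitivity of the trace: the upper half of the sum is the lower half applied to the
  conjugate, and \<open>t\<close> passes through because it is fixed by the conjugation.\<close>

lemma partial_trace_double:
  assumes "m = 2 * h" "t \<in> fixed_field h"
  shows "partial_trace m (t * s) = partial_trace h (t * (s ^ (p ^ h) + s))"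
proof -
  have "(t * s) ^ (p ^ (h + i)) = (t * s ^ (p ^ h)) ^ (p ^ i)" for i
    using assms(2) by (simp add: fixed_field_def power_add power_mult power_mult_distrib)
  then have "partial_trace m (t * s) = (\<Sum>i<h. (t * s) ^ (p ^ i)) + (\<Sum>i<h. (t * s ^ (p ^ h)) ^ (p ^ i))"
    unfolding partial_trace_def assms(1) mult_2 sum_lessThan_add by simp
  then show ?thesis
    by (simp add: partial_trace_add partial_trace_def distrib_left frobenius_add sum.distrib add.commute)
qed

text \<open>With \<open>q = p ^ h\<close>, the Euler exponent (q^2 - 1)/2 is a multiple of
  \<open>q - 1\<close>, the exponent that kills the nonzero elements of the subfield.\<close>

lemma fixed_field_square:
  assumes "m = 2 * h" "t \<in> fixed_field h"
  shows "\<exists>x. t = x\<^sup>2"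
proof (cases "t = 0")
  case False
  define q where "q = p ^ h"
  have "odd q" using odd_p by (simp add: q_def)
  then obtain k where k: "q = 2 * k + 1" by (auto elim: oddE)
  have "t ^ (q - 1) = 1"
  proof -
    have "t * t ^ (q - 1) = t ^ q" using k by simp
    then show ?thesis using assms(2) False by (simp add: fixed_field_def q_def)
  qed
  moreover have "(CARD('k) - 1) div 2 = (q - 1) * (k + 1)"
    unfolding card_k_double[OF assms(1), folded q_def] k by simp
  ultimately have "t ^ ((CARD('k) - 1) div 2) = 1" by (simp only: power_mult power_one)
  then show ?thesis using finite_field_square_iff[OF two_k False] by simp
qed auto

text \<open>Here the power \<open>q - 1\<close> gives -1, with \<open>q = p ^ h\<close>, and the
  Euler exponent is \<open>q - 1\<close> times (q + 1)/2, so the criterion yields -1 to the power (q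
  + 1)/2. The answer is the same along the whole line.\<close>

lemma skew_square_iff:
  assumes "m = 2 * h" "s \<in> skew_field_part h" "s \<noteq> 0"
  shows "(\<exists>x. s = x\<^sup>2) \<longleftrightarrow> even ((p ^ h + 1) div 2)"
proof -
  define q where "q = p ^ h"
  have "odd q" using odd_p by (simp add: q_def)
  then obtain k where k: "q = 2 * k + 1" by (auto elim: oddE)
  have "s ^ (q - 1) = -1"
  proof -
    have "s * s ^ (q - 1) = s ^ q" using k by simp
    then have "s * s ^ (q - 1) = s * (-1)" using assms(2) by (simp add: skew_field_part_def q_def)
    then show ?thesis using assms(3) by (simp only: mult_cancel_left) simp
  qed
  moreover have "(CARD('k) - 1) div 2 = (q - 1) * (k + 1)"
    unfolding card_k_double[OF assms(1), folded q_def] k by simp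
  ultimately have "s ^ ((CARD('k) - 1) div 2) = (-1) ^ (k + 1)" by (simp only: power_mult)
  moreover have "(1::'k) \<noteq> -1" by (rule one_neq_minus_one[OF two_k])
  ultimately show ?thesis
    using finite_field_square_iff[OF two_k assms(3)] k by (simp add: minus_one_power_iff flip: q_def)
qed

text \<open>All of \<open>\<F>\<^sub>q\<^sup>*\<close>, \<open>q = p ^ h\<close>, consists of squares in the field with \<open>q\<^sup>2\<close> elements, so averaging over the
  scalars \<open>t\<close> reduces the trace of a square \<open>s\<close> to its relative trace \<open>s ^ q + s\<close>, which
  vanishes on a line.\<close>

lemma card_squares_trace:
  assumes "m = 2 * h"
  defines "q \<equiv> p ^ h" and "S \<equiv> {s::'k. s \<noteq> 0 \<and> (\<exists>x. s = x\<^sup>2)}"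
  shows "(q - 1) * card {s \<in> S. tr s = u} = card (S \<inter> skew_field_part h) * (if u = 0 then q - 1 else 0)
    + card (S - skew_field_part h) * (p ^ (h - 1) - (if u = 0 then 1 else 0))"
proof -
  have "h > 0" using assms(1) m_pos by simp
  define F where "F = fixed_field h - {0}"
  have F: "t \<noteq> 0" "t ^ q = t" "t \<in> fixed_field h" if "t \<in> F" for t
    using that by (auto simp: F_def fixed_field_def q_def)
  have cF: "card F = q - 1"
    using card_fixed_and_skew[OF assms(1)] by (simp add: F_def q_def zero_fixed)
  have "(q - 1) * card {s \<in> S. tr s = u} = (\<Sum>t\<in>F. card {s \<in> S. tr (t * s) = u})"
  proof -
    \<comment> \<open>Since \<open>t\<close> is itself a square, multiplication by it permutes the
      nonzero squares.\<close>
    have "card {s \<in> S. tr (t * s) = u} = card {s \<in> S. tr s = u}" if t: "t \<in> F" for t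
    proof -
      obtain y where y: "t = y\<^sup>2" using fixed_field_square[OF assms(1) F(3)[OF t]] by auto
      have "t * s \<in> S" if "s \<in> S" for s
      proof -
        from that obtain x where "s = x\<^sup>2" "s \<noteq> 0" by (auto simp: S_def)
        then have "t * s = (y * x)\<^sup>2" "t * s \<noteq> 0" using y F(1)[OF t] by (auto simp: power_mult_distrib)
        then show ?thesis unfolding S_def by blast
      qed
      moreover have "s / t \<in> S" if "s \<in> S" for s
      proof -
        from that obtain x where "s = x\<^sup>2" "s \<noteq> 0" by (auto simp: S_def)
        then have "s / t = (x / y)\<^sup>2" "s / t \<noteq> 0" using y F(1)[OF t] by (auto simp: power_divide)
        then show ?thesis unfolding S_def by blast
      qed
      ultimately have "bij_betw ((*) t) {s \<in> S. tr (t * s) = u} {s \<in> S. tr s = u}"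
        by (intro bij_betw_byWitness[where f' = "\<lambda>s. s / t"]) (use F(1)[OF t] in auto)
      from bij_betw_same_card[OF this] show ?thesis .
    qed
    then show ?thesis by (simp add: cF)
  qed
  also have "\<dots> = (\<Sum>s\<in>S. card {t \<in> F. tr (t * s) = u})"
    by (rule card_double_fibre) auto
  also have "\<dots> = (\<Sum>s\<in>S \<inter> skew_field_part h. card {t \<in> F. tr (t * s) = u})
      + (\<Sum>s\<in>S - skew_field_part h. card {t \<in> F. tr (t * s) = u})"
    by (rule sum.Int_Diff) simp
  also have "(\<Sum>s\<in>S \<inter> skew_field_part h. card {t \<in> F. tr (t * s) = u})
      = (\<Sum>s\<in>S \<inter> skew_field_part h. if u = 0 then q - 1 else 0)"
  proof (rule sum.cong[OF refl])
    fix s assume "s \<in> S \<inter> skew_field_part h"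
    then have "s ^ (p ^ h) + s = 0" by (simp add: skew_field_part_def)
    then have "tr (t * s) = 0" if "t \<in> F" for t
      using partial_trace_double[OF assms(1) F(3)[OF that], of s]
      by (simp add: partial_trace_def emb_tr p_ge_3 flip: emb_eq_iff)
        (use p_ge_3 in \<open>auto simp: power_0_left intro!: sum.neutral\<close>)
    then have "{t \<in> F. tr (t * s) = u} = (if u = 0 then F else {})" by auto
    then show "card {t \<in> F. tr (t * s) = u} = (if u = 0 then q - 1 else 0)" by (simp add: cF)
  qed
  also have "(\<Sum>s\<in>S - skew_field_part h. card {t \<in> F. tr (t * s) = u})
      = (\<Sum>s\<in>S - skew_field_part h. p ^ (h - 1) - (if u = 0 then 1 else 0))"
  proof (rule sum.cong[OF refl])
    fix s assume s: "s \<in> S - skew_field_part h"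
    define r where "r = s ^ q + s"
    have "r \<noteq> 0" using s by (simp add: r_def skew_field_part_def q_def eq_neg_iff_add_eq_0)
    have "(s ^ q) ^ q = s"
      using frobenius_m[of s] assms(1) by (simp add: q_def mult_2 power_add power_mult)
    then have r: "r ^ q = r" by (simp add: r_def q_def frobenius_add add.commute)
    \<comment> \<open>Multiplication by the relative trace \<open>r\<close>, a nonzero subfield
      element, permutes \<open>F\<close>, so only a fibre of the subfield trace has to be counted.
      The fibre over 0 loses one element because \<open>F\<close> omits 0.\<close>
    have "bij_betw (\<lambda>t. t * r) {t \<in> F. tr (t * s) = u} {y \<in> F. partial_trace h y = emb u}"
    proof (rule bij_betw_byWitness[where f' = "\<lambda>y. y / r"])
      have iff: "tr (t * s) = u \<longleftrightarrow> partial_trace h (t * r) = emb u" if "t \<in> F" for t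
        using partial_trace_double[OF assms(1) F(3)[OF that], of s]
        by (simp add: emb_tr r_def q_def flip: emb_eq_iff)
      have rF: "t * r \<in> F" "t / r \<in> F" if "t \<in> F" for t
        using F(1,2)[OF that] r \<open>r \<noteq> 0\<close>
        by (simp_all add: F_def fixed_field_def power_mult_distrib power_divide flip: q_def)
      then show "(\<lambda>t. t * r) ` {t \<in> F. tr (t * s) = u} \<subseteq> {y \<in> F. partial_trace h y = emb u}"
        using iff by auto
      have "tr (y / r * s) = u \<longleftrightarrow> partial_trace h y = emb u" if "y \<in> F" for y
        using iff[OF rF(2)[OF that]] \<open>r \<noteq> 0\<close> by simp
      then show "(\<lambda>y. y / r) ` {y \<in> F. partial_trace h y = emb u} \<subseteq> {t \<in> F. tr (t * s) = u}"
        using rF by auto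
    qed (use \<open>r \<noteq> 0\<close> in auto)
    then have "card {t \<in> F. tr (t * s) = u} = card {y \<in> F. partial_trace h y = emb u}"
      by (rule bij_betw_same_card)
    also have "\<dots> = p ^ (h - 1) - (if u = 0 then 1 else 0)"
    proof -
      have "partial_trace h 0 = 0" using p_ge_3 by (simp add: partial_trace_def power_0_left)
      then have "{y \<in> F. partial_trace h y = emb u}
          = {y \<in> fixed_field h. partial_trace h y = emb u} - (if u = 0 then {0} else {})"
        and "u = 0 \<Longrightarrow> 0 \<in> {y \<in> fixed_field h. partial_trace h y = emb u}"
        using p_ge_3 by (auto simp: F_def fixed_field_def power_0_left)
      then show ?thesis
        using card_partial_trace_fibre[of h u] card_fixed_and_skew[OF assms(1)] \<open>h > 0\<close>
        by (cases "u = 0") simp_all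
    qed
    finally show "card {t \<in> F. tr (t * s) = u} = p ^ (h - 1) - (if u = 0 then 1 else 0)" .
  qed
  finally show ?thesis by simp
qed

lemma sq_count_even:
  assumes "m = 2 * h"
  defines "\<epsilon> \<equiv> (-1::int) ^ (h * ((p - 1) div 2)\<^sup>2)"
  shows "int (sq_count u) = int p ^ (m - 1) - \<epsilon> * int p ^ (h - 1) * (if u = 0 then int p - 1 else -1)"
proof -
  define q where "q = p ^ h"
  define Q where "Q = int p ^ (h - 1)"
  define S where "S = {s::'k. s \<noteq> 0 \<and> (\<exists>x. s = x\<^sup>2)}"
  have "h > 0" using assms(1) m_pos by simp
  have "odd q" using odd_p by (simp add: q_def)
  then obtain k where k: "q = 2 * k + 1" by (auto elim: oddE)
  have "q \<ge> p" using \<open>h > 0\<close> p_ge_3 by (simp add: q_def self_le_power)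
  then have "k > 0" using k p_ge_3 by simp
  have pQ: "int q = int p * Q" using \<open>h > 0\<close> by (cases h) (simp_all add: q_def Q_def)
  \<comment> \<open>Indicator of the skew line consisting of squares; \<open>k + 1\<close> is (q +
    1)/2. This is the only place where the sign enters.\<close>
  define j where "j = (if even (k + 1) then 1 else 0 :: int)"
  have eps: "\<epsilon> = 1 - 2 * j"
    using odd_power_half_parity[OF odd_p, of h] k by (simp add: \<epsilon>_def j_def flip: q_def)
  have "int (card S) = (2 * int k) * (int k + 1)"
  proof -
    have "2 * card S = q * q - 1"
      using card_nonzero_squares[OF two_k] card_k_double[OF assms(1)] by (simp add: S_def q_def)
    also have "\<dots> = 2 * (2 * k * (k + 1))" unfolding k by simp
    finally have "card S = 2 * k * (k + 1)" by simp
    then show ?thesis by (simp add: distrib_left)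
  qed
  moreover have SE: "int (card (S \<inter> skew_field_part h)) = 2 * int k * j"
  proof -
    \<comment> \<open>All or nothing: being a square is decided uniformly on the nonzero skew
      elements.\<close>
    have "S \<inter> skew_field_part h = (if even (k + 1) then skew_field_part h - {0} else {})"
      using skew_square_iff[OF assms(1)] k by (auto simp: S_def simp flip: q_def)
    moreover have "0 \<in> skew_field_part h" using p_ge_3 by (simp add: skew_field_part_def power_0_left)
    ultimately show ?thesis
      using card_fixed_and_skew(2)[OF assms(1)] k by (simp add: j_def flip: q_def)
  qed
  moreover have "card S = card (S \<inter> skew_field_part h) + card (S - skew_field_part h)"
    by (subst card_Un_disjoint[symmetric]) (auto intro: arg_cong[where f = card])
  ultimately have SD: "int (card (S - skew_field_part h)) = 2 * int k * (int k + 1 - j)"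
    by (simp add: algebra_simps)
  have "int ((q - 1) * card {s \<in> S. tr s = u})
      = 2 * int k * j * (if u = 0 then 2 * int k else 0)
        + 2 * int k * (int k + 1 - j) * (Q - (if u = 0 then 1 else 0))"
    unfolding card_squares_trace[OF assms(1), folded q_def S_def] of_nat_add of_nat_mult SE SD
    using p_ge_3 k by (simp add: Q_def of_nat_diff)
  then have "(2 * int k) * int (card {s \<in> S. tr s = u}) = (2 * int k) *
      (j * (if u = 0 then 2 * int k else 0) + (int k + 1 - j) * (Q - (if u = 0 then 1 else 0)))"
    by (simp add: k algebra_simps)
  then have "int (card {s \<in> S. tr s = u}) =
      j * (if u = 0 then 2 * int k else 0) + (int k + 1 - j) * (Q - (if u = 0 then 1 else 0))"
    using \<open>k > 0\<close> by (simp only: mult_cancel_left) simp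
  then have "2 * int (card {s \<in> S. tr s = u}) =
      2 * j * (if u = 0 then 2 * int k else 0) + (2 * int k + 2 - 2 * j) * (Q - (if u = 0 then 1 else 0))"
    by (simp only:) (simp add: algebra_simps)
  moreover have "int (sq_count u) = 2 * int (card {s \<in> S. tr s = u}) + (if u = 0 then 1 else 0)"
    using sq_count_eq_squares[of u] by (simp add: S_def conj_assoc)
  moreover have k': "2 * int k = int p * Q - 1" using pQ k by simp
  ultimately have "int (sq_count u) = 2 * j * (if u = 0 then int p * Q - 1 else 0)
      + (int p * Q - 1 + 2 - 2 * j) * (Q - (if u = 0 then 1 else 0)) + (if u = 0 then 1 else 0)"
    unfolding k' by (simp only:)
  moreover have "int p ^ (m - 1) = int p * Q * Q"
    unfolding pQ[symmetric]
    using \<open>h > 0\<close> unfolding q_def Q_def assms(1) of_nat_power power_add[symmetric] by (simp add: mult_2)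
  ultimately show ?thesis
    unfolding eps Q_def[symmetric] by (cases "u = 0") (simp_all add: algebra_simps)
qed

end

section \<open>The code\<close>

text \<open>Coordinates in a basis \<open>B\<close> match \<open>C\<close> with the functions from
  \<open>B\<close> to the scalars, so the cardinality is that of the field to the power of the
  dimension. This spares exhibiting a basis of the trace code.\<close>

lemma is_linear_code_of_card:
  fixes C :: "'f::{field,finite} vec set"
  assumes carrier: "C \<subseteq> carrier_vec n" and zero: "0\<^sub>v n \<in> C"
    and add: "\<And>u v. u \<in> C \<Longrightarrow> v \<in> C \<Longrightarrow> u + v \<in> C"
    and smult: "\<And>c v. v \<in> C \<Longrightarrow> c \<cdot>\<^sub>v v \<in> C"
    and card: "card C = CARD('f) ^ k"
  shows "is_linear_code n k C"
proof -
  interpret V: vectorspace "class_ring :: 'f ring" "module_vec TYPE('f) n" by (rule vec_vs)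
  have sub: "VectorSpace.subspace class_ring C (module_vec TYPE('f) n)"
    by (intro subspace.intro submodule.intro vec_vs vec_module)
      (use assms in \<open>auto simp: module_vec_simps\<close>)
  interpret W: vectorspace "class_ring :: 'f ring" "(module_vec TYPE('f) n)\<lparr>carrier := C\<rparr>"
    by (rule V.subspace_is_vs[OF sub])
  have fin: "finite C" using card by (intro card_ge_0_finite) simp
  \<comment> \<open>Finite dimension is obtained cheaply: the finite space generates itself.\<close>
  have "W.gen_set C"
    using W.in_own_span[of C] W.span_is_subset2[of C] by auto
  then have "W.fin_dim" unfolding W.fin_dim_def using fin by auto
  then obtain B where B: "finite B" "W.basis B" using W.finite_basis_exists by auto
  have BC: "B \<subseteq> C" using B(2) by (simp add: W.basis_def)
  have ex1: "\<exists>!a. a \<in> B \<rightarrow>\<^sub>E UNIV \<and> W.lincomb a B = v" if "v \<in> C" for v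
    using W.basis_criterion[OF B(1)] BC B(2) that by simp
  have "bij_betw (\<lambda>a. W.lincomb a B) (B \<rightarrow>\<^sub>E (UNIV :: 'f set)) C"
  proof (rule bij_betwI')
    have closed: "W.lincomb a B \<in> C" for a
      using W.lincomb_closed[of B a] BC by auto
    then show "\<And>a. a \<in> B \<rightarrow>\<^sub>E (UNIV :: 'f set) \<Longrightarrow> W.lincomb a B \<in> C" by simp
    show "W.lincomb a B = W.lincomb b B \<longleftrightarrow> a = b"
      if "a \<in> B \<rightarrow>\<^sub>E (UNIV :: 'f set)" "b \<in> B \<rightarrow>\<^sub>E (UNIV :: 'f set)" for a b
      using ex1[OF closed[of b]] that by auto
  qed (use ex1 in metis)
  from bij_betw_same_card[OF this] have "card C = CARD('f) ^ card B"
    by (simp add: card_funcsetE[OF B(1)])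
  moreover have "CARD('f) > 1"
    using card_mono[of UNIV "{0::'f, 1}"] by simp
  ultimately have "card B = k" using card by simp
  then have "W.dim = k" using W.dim_basis[OF B] by simp
  then show ?thesis using sub by (simp add: is_linear_code_def)
qed

context odd_trace
begin

section \<open>Symbol counts and injectivity of the encoding\<close>

definition isotropic :: "'k set" where
  "isotropic = {x. x \<noteq> 0 \<and> tr (x\<^sup>2) = 0}"

lemma isotropic_iff: "x \<in> isotropic \<longleftrightarrow> x \<noteq> 0 \<and> tr (x\<^sup>2) = 0"
  by (simp add: isotropic_def)

lemma card_isotropic: "card isotropic = sq_count 0 - 1"
proof -
  have "isotropic = {x. tr (x\<^sup>2) = 0} - {0}" by (auto simp: isotropic_iff)
  then show ?thesis by (simp add: sq_count_def)
qed

lemma sq_count_0_pos: "sq_count 0 > 0"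
  by (auto simp: sq_count_def card_gt_0_iff intro!: exI[of _ 0])

text \<open>The value 1 represents every nonzero value, by
  \<open>card_sq_orth_scale\<close>.\<close>

definition sq_count_tail :: "'k \<Rightarrow> nat" where
  "sq_count_tail a = card {x. tr (x\<^sup>2) = 0 \<and> tr (a * x) = 1}"

lemma card_isotropic_fibre:
  "card {x \<in> isotropic. tr (a * x) = c} = (if c = 0 then sq_count_orth a - 1 else sq_count_tail a)"
proof (cases "c = 0")
  case True
  then have "{x \<in> isotropic. tr (a * x) = c} = {x. tr (x\<^sup>2) = 0 \<and> tr (a * x) = 0} - {0}"
    by (auto simp: isotropic_iff)
  then show ?thesis using True by (simp add: sq_count_orth_def)
next
  case False
  then have "{x \<in> isotropic. tr (a * x) = c} = {x. tr (x\<^sup>2) = 0 \<and> tr (a * x) = c}"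
    by (auto simp: isotropic_iff)
  then show ?thesis using False card_sq_orth_scale[OF False] by (simp add: sq_count_tail_def)
qed

lemma trace_code_eq: "trace_code m n d = (\<lambda>(a, b). vec n (\<lambda>i. tr (a * d i) + b)) ` UNIV"
  by (auto simp: trace_code_def)

text \<open>Symbol \<open>j\<close> occurs where the trace equals \<open>j - b\<close>, so
  \<open>b\<close> takes over the role of the trace value 0. The \<open>- 1\<close> in its exponent
  is the zero vector, which is not in D.\<close>

lemma word_monom_codeword:
  assumes "bij_betw d {..<n} isotropic"
  shows "word_monom (vec n (\<lambda>i. tr (a * d i) + b))
    = w b ^ (sq_count_orth a - 1) * (\<Prod>\<rho>\<in>UNIV - {b}. w \<rho> ^ sq_count_tail a)"
proof -
  have c: "card {i. i < dim_vec (vec n (\<lambda>i. tr (a * d i) + b)) \<and> vec n (\<lambda>i. tr (a * d i) + b) $ i = j}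
      = (if j = b then sq_count_orth a - 1 else sq_count_tail a)" for j
  proof -
    have "bij_betw d {i \<in> {..<n}. tr (a * d i) = j - b} {x \<in> isotropic. tr (a * x) = j - b}"
      using assms by (auto simp: bij_betw_def inj_on_def)
    then have "card {i \<in> {..<n}. tr (a * d i) = j - b} = card {x \<in> isotropic. tr (a * x) = j - b}"
      by (rule bij_betw_same_card)
    moreover have "{i. i < dim_vec (vec n (\<lambda>i. tr (a * d i) + b)) \<and> vec n (\<lambda>i. tr (a * d i) + b) $ i = j}
        = {i \<in> {..<n}. tr (a * d i) = j - b}"
      by (auto simp: algebra_simps)
    ultimately show ?thesis by (simp add: card_isotropic_fibre)
  qed
  show ?thesis
    unfolding word_monom_def c by (subst prod.remove[of _ b]) (auto intro!: prod.cong)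
qed

text \<open>If two words agree, the trace form of \<open>a - a'\<close> is constant on D. But D is
  closed under negation, and a positive tail supplies a point of value 1 and hence one of value -1.
  Any single coordinate then recovers \<open>b\<close>.\<close>

lemma inj_codeword:
  assumes d: "bij_betw d {..<n} isotropic" and "n \<ge> 1" and tail: "\<And>a. a \<noteq> 0 \<Longrightarrow> sq_count_tail a > 0"
  shows "inj (\<lambda>(a, b). vec n (\<lambda>i. tr (a * d i) + b))"
proof (rule injI, clarify)
  fix a b a' b'
  assume eq: "vec n (\<lambda>i. tr (a * d i) + b) = vec n (\<lambda>i. tr (a' * d i) + b')"
  have const: "tr ((a - a') * x) = b' - b" if "x \<in> isotropic" for x
  proof -
    from that d obtain i where i: "i < n" "x = d i" by (auto simp: bij_betw_def)
    have "vec n (\<lambda>i. tr (a * d i) + b) $ i = vec n (\<lambda>i. tr (a' * d i) + b') $ i" by (simp only: eq)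
    then have "tr (a * x) + b = tr (a' * x) + b'" using i by simp
    then show ?thesis by (simp add: left_diff_distrib tr_diff algebra_simps)
  qed
  have "a = a'"
  proof (rule ccontr)
    assume "a \<noteq> a'"
    then have "sq_count_tail (a - a') > 0" using tail by simp
    then obtain x where x: "tr (x\<^sup>2) = 0" "tr ((a - a') * x) = 1"
      by (auto simp: sq_count_tail_def card_gt_0_iff)
    then have "x \<in> isotropic" "- x \<in> isotropic" by (auto simp: isotropic_iff)
    from const[OF this(1)] const[OF this(2)] x(2) have "(1::'p mod_ring) = -1"
      by (simp add: tr_uminus)
    then show False using one_neq_minus_one[OF two_F] by simp
  qed
  moreover have "b = b'"
  proof -
    have "d 0 \<in> isotropic" using d \<open>n \<ge> 1\<close> by (auto simp: bij_betw_def)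
    from const[OF this] show ?thesis using \<open>a = a'\<close> by simp
  qed
  ultimately show "a = a' \<and> b = b'" by simp
qed

text \<open>Contribution of the \<open>p\<close> codewords that share \<open>a\<close>. With
  \<open>s = 0\<close> it covers the constant words.\<close>

definition weight_orbit :: "nat \<Rightarrow> nat \<Rightarrow> 'p mod_ring enum_poly" where
  "weight_orbit r s = (\<Sum>b\<in>UNIV. w b ^ r * (\<Prod>\<rho>\<in>UNIV - {b}. w \<rho> ^ s))"

lemma is_linear_trace_code:
  assumes d: "bij_betw d {..<n} isotropic" and "n \<ge> 1" and tail: "\<And>a. a \<noteq> 0 \<Longrightarrow> sq_count_tail a > 0"
  shows "is_linear_code n (m + 1) (trace_code m n d :: 'p mod_ring vec set)"
proof (rule is_linear_code_of_card)
  let ?C = "trace_code m n d :: 'p mod_ring vec set"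
  show "?C \<subseteq> carrier_vec n" by (auto simp: trace_code_def)
  have mem: "vec n (\<lambda>i. tr (a * d i) + b) \<in> ?C" for a b by (auto simp: trace_code_def)
  have "0\<^sub>v n = vec n (\<lambda>i. tr (0 * d i) + 0)" by auto
  then show "0\<^sub>v n \<in> ?C" using mem by metis
  show "u + v \<in> ?C" if "u \<in> ?C" "v \<in> ?C" for u v
  proof -
    from that obtain a b a' b' where "u = vec n (\<lambda>i. tr (a * d i) + b)" "v = vec n (\<lambda>i. tr (a' * d i) + b')"
      by (auto simp: trace_code_def)
    then have "u + v = vec n (\<lambda>i. tr ((a + a') * d i) + (b + b'))"
      by (auto simp: distrib_right tr_add algebra_simps)
    then show ?thesis using mem by metis
  qed
  show "c \<cdot>\<^sub>v v \<in> ?C" if "v \<in> ?C" for c v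
  proof -
    from that obtain a b where "v = vec n (\<lambda>i. tr (a * d i) + b)"
      by (auto simp: trace_code_def)
    then have "c \<cdot>\<^sub>v v = vec n (\<lambda>i. tr ((emb c * a) * d i) + c * b)"
      by (auto simp: mult.assoc tr_emb_mult distrib_left)
    then show ?thesis using mem by metis
  qed
  have "card ?C = card (UNIV :: ('k \<times> 'p mod_ring) set)"
    unfolding trace_code_eq by (rule card_image[OF inj_codeword[OF assms]])
  also have "\<dots> = p ^ m * p"
    using card_k card_p by (simp add: card_cartesian_product flip: UNIV_Times_UNIV)
  finally show "card ?C = CARD('p mod_ring) ^ (m + 1)"
    by (simp add: card_p)
qed

lemma CWE_trace_code:
  assumes d: "bij_betw d {..<n} isotropic" and "n \<ge> 1" and tail: "\<And>a. a \<noteq> 0 \<Longrightarrow> sq_count_tail a > 0"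
  shows "CWE (trace_code m n d :: 'p mod_ring vec set)
    = (\<Sum>a\<in>UNIV. weight_orbit (sq_count_orth a - 1) (sq_count_tail a))"
proof -
  have "CWE (trace_code m n d :: 'p mod_ring vec set)
      = (\<Sum>(a, b)\<in>UNIV. word_monom (vec n (\<lambda>i. tr (a * d i) + b)))"
    unfolding CWE_def trace_code_eq
    by (subst sum.reindex[OF inj_codeword[OF assms]]) (assumption, rule sum.cong, auto)
  also have "\<dots> = (\<Sum>a\<in>UNIV. \<Sum>b\<in>UNIV. word_monom (vec n (\<lambda>i. tr (a * d i) + b)))"
    by (simp add: sum.cartesian_product)
  finally show ?thesis
    unfolding word_monom_codeword[OF d] by (simp add: weight_orbit_def)
qed

lemma sq_count_orth_0: "sq_count_orth 0 = sq_count 0" "sq_count_tail 0 = 0"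
  by (simp_all add: sq_count_orth_def sq_count_def sq_count_tail_def)

text \<open>Separates \<open>a = 0\<close> (constant words), nonzero isotropic \<open>a\<close> and
  the rest. The nonzero isotropic \<open>a\<close> form D itself, which is why the length of the
  code reappears as a coefficient.\<close>

lemma sum_weight_orbit_by_norm:
  assumes "m \<ge> 2"
  shows "(\<Sum>a\<in>UNIV. weight_orbit (sq_count_orth a - 1) (sq_count_tail a)) =
    weight_orbit (sq_count 0 - 1) 0
    + of_nat (sq_count 0 - 1) * weight_orbit (sq_count 0 - 1 - (p - 1) * p ^ (m - 2)) (p ^ (m - 2))
    + (\<Sum>a | tr (a\<^sup>2) \<noteq> 0. weight_orbit (sq_count_orth a - 1) (sq_count_tail a))"
proof -
  let ?g = "\<lambda>a. weight_orbit (sq_count_orth a - 1) (sq_count_tail a)"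
  have "(UNIV::'k set) = insert 0 (isotropic \<union> {a. tr (a\<^sup>2) \<noteq> 0})" by (auto simp: isotropic_iff)
  then have "sum ?g UNIV = sum ?g (insert 0 (isotropic \<union> {a. tr (a\<^sup>2) \<noteq> 0}))" by simp
  also have "\<dots> = ?g 0 + (sum ?g isotropic + sum ?g {a. tr (a\<^sup>2) \<noteq> 0})"
    by (subst sum.insert, simp, simp add: isotropic_iff, subst sum.union_disjoint) (auto simp: isotropic_iff)
  also have "sum ?g isotropic = (\<Sum>a\<in>isotropic. weight_orbit (sq_count 0 - 1 - (p - 1) * p ^ (m - 2)) (p ^ (m - 2)))"
  proof (rule sum.cong[OF refl])
    fix a assume "a \<in> isotropic"
    then have "sq_count_tail a = p ^ (m - 2)"
      using card_sq_orth_isotropic[OF _ _ assms] by (simp add: isotropic_iff sq_count_tail_def)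
    then show "?g a = weight_orbit (sq_count 0 - 1 - (p - 1) * p ^ (m - 2)) (p ^ (m - 2))"
      using sq_count_0_split[of a] by (simp add: sq_count_tail_def)
  qed
  finally show ?thesis by (simp add: card_isotropic sq_count_orth_0 add.assoc)
qed

section \<open>Explicit counts for anisotropic multipliers\<close>

lemma power_shift:
  assumes "i \<ge> 2"
  shows "int p ^ (i - 1) = int p * int p ^ (i - 2)"
proof -
  have "i - 1 = Suc (i - 2)" using assms by simp
  then show ?thesis by (simp only: power_Suc)
qed

text \<open>The double count and the splitting of V 0, moved to the integers; the term with
  \<open>p ^ (m - 1)\<close> is absorbed into the deviation.\<close>

lemma anisotropic_counts:
  assumes "tr (a\<^sup>2) \<noteq> 0"
  shows "int p * int (sq_count_orth a)
      = int (sq_count 0) + (int p - 1) * sq_defect (tr (a\<^sup>2))"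
    and "(int p - 1) * int (sq_count_tail a) = int (sq_count 0) - int (sq_count_orth a)"
proof -
  have p1: "int (p - 1) = int p - 1" using p_ge_3 by (simp add: of_nat_diff)
  have "int (p * sq_count_orth a + (p - 1) * p ^ (m - 1)) = int (sq_count 0 + (p - 1) * sq_count (tr (a\<^sup>2)))"
    by (simp only: sq_count_orth_anisotropic[OF assms])
  then have "int p * int (sq_count_orth a) + (int p - 1) * int (p ^ (m - 1))
      = int (sq_count 0) + (int p - 1) * int (sq_count (tr (a\<^sup>2)))"
    by (simp only: of_nat_add of_nat_mult p1)
  then show "int p * int (sq_count_orth a) = int (sq_count 0) + (int p - 1) * sq_defect (tr (a\<^sup>2))"
    by (simp only: sq_defect_def right_diff_distrib)
  show "(int p - 1) * int (sq_count_tail a) = int (sq_count 0) - int (sq_count_orth a)"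
  proof -
    have "int (sq_count 0) = int (sq_count_orth a + (p - 1) * sq_count_tail a)"
      unfolding sq_count_tail_def by (simp only: sq_count_0_split[of a])
    then show ?thesis by (simp only: of_nat_add of_nat_mult p1)
  qed
qed

text \<open>\<open>\<sigma>\<close> stands for the sign of the deviation, a parameter so that both
  signs share one computation.\<close>

lemma anisotropic_counts_odd:
  assumes "odd m" "m \<ge> 3" "tr (a\<^sup>2) \<noteq> 0" "sq_defect (tr (a\<^sup>2)) = \<sigma> * int p ^ ((m - 1) div 2)"
  shows "int (sq_count_orth a) = int p ^ (m - 2) + \<sigma> * (int p - 1) * int p ^ ((m - 3) div 2)"
    and "int (sq_count_tail a) = int p ^ (m - 2) - \<sigma> * int p ^ ((m - 3) div 2)"
proof -
  have "(m - 1) div 2 = Suc ((m - 3) div 2)" using assms(2) by presburger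
  then have half: "int p ^ ((m - 1) div 2) = int p * int p ^ ((m - 3) div 2)" by (simp only: power_Suc)
  have V0: "int (sq_count 0) = int p * int p ^ (m - 2)"
    using sq_count_0_odd[OF assms(1)] power_shift[of m] assms(2) by simp
  have "int p * int (sq_count_orth a)
      = int p * (int p ^ (m - 2) + \<sigma> * (int p - 1) * int p ^ ((m - 3) div 2))"
    unfolding anisotropic_counts(1)[OF assms(3)] assms(4) V0 half by (simp add: algebra_simps)
  then show orth: "int (sq_count_orth a) = int p ^ (m - 2) + \<sigma> * (int p - 1) * int p ^ ((m - 3) div 2)"
    using p_ge_3 by (simp only: mult_cancel_left) simp
  have "(int p - 1) * int (sq_count_tail a) = (int p - 1) * (int p ^ (m - 2) - \<sigma> * int p ^ ((m - 3) div 2))"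
    unfolding anisotropic_counts(2)[OF assms(3)] V0 orth by (simp add: algebra_simps)
  then show "int (sq_count_tail a) = int p ^ (m - 2) - \<sigma> * int p ^ ((m - 3) div 2)"
    using p_ge_3 by (simp only: mult_cancel_left) simp
qed

lemma sq_count_0_even:
  assumes "m = 2 * h"
  defines "\<epsilon> \<equiv> (-1::int) ^ (h * ((p - 1) div 2)\<^sup>2)"
  shows "int (sq_count 0) = int p ^ (m - 1) - \<epsilon> * (int p - 1) * int p ^ (h - 1)"
  using sq_count_even[OF assms(1), of 0] by (simp add: \<epsilon>_def algebra_simps)

text \<open>The correction in V 0 and \<open>p - 1\<close> times the deviation at a nonzero value
  cancel, so \<open>\<epsilon>\<close> disappears from the first count and survives only in the
  tail.\<close>

lemma anisotropic_counts_even: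
  assumes "m = 2 * h" "tr (a\<^sup>2) \<noteq> 0"
  defines "\<epsilon> \<equiv> (-1::int) ^ (h * ((p - 1) div 2)\<^sup>2)"
  shows "int (sq_count_orth a) = int p ^ (m - 2)"
    and "int (sq_count_tail a) = int p ^ (m - 2) - \<epsilon> * int p ^ (h - 1)"
proof -
  have "m \<ge> 2" using assms(1) m_pos by simp
  have V0: "int (sq_count 0) = int p * int p ^ (m - 2) - \<epsilon> * (int p - 1) * int p ^ (h - 1)"
    using sq_count_0_even[OF assms(1)] power_shift[OF \<open>m \<ge> 2\<close>] by (simp add: \<epsilon>_def)
  have "sq_defect (tr (a\<^sup>2)) = \<epsilon> * int p ^ (h - 1)"
    using sq_count_even[OF assms(1), of "tr (a\<^sup>2)"] assms(2) by (simp add: sq_defect_def \<epsilon>_def)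
  then have "int p * int (sq_count_orth a) = int p * int p ^ (m - 2)"
    unfolding anisotropic_counts(1)[OF assms(2)] V0 by simp
  then show orth: "int (sq_count_orth a) = int p ^ (m - 2)"
    using p_ge_3 by (simp only: mult_cancel_left) simp
  have "(int p - 1) * int (sq_count_tail a) = (int p - 1) * (int p ^ (m - 2) - \<epsilon> * int p ^ (h - 1))"
    unfolding anisotropic_counts(2)[OF assms(2)] V0 orth by (simp add: algebra_simps)
  then show "int (sq_count_tail a) = int p ^ (m - 2) - \<epsilon> * int p ^ (h - 1)"
    using p_ge_3 by (simp only: mult_cancel_left) simp
qed

text \<open>At nonzero values the deviation takes two opposite values, and it vanishes at 0. As the
  deviations sum to zero, both signs occur equally often.\<close>

lemma card_defect_values_odd:
  assumes "odd m"
  shows "2 * int (card {u. sq_defect u = int p ^ ((m - 1) div 2)}) = int p - 1"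
    and "2 * int (card {u. sq_defect u = - (int p ^ ((m - 1) div 2))}) = int p - 1"
    and "u \<noteq> 0 \<Longrightarrow> sq_defect u = int p ^ ((m - 1) div 2) \<or> sq_defect u = - (int p ^ ((m - 1) div 2))"
proof -
  define P where "P = int p ^ ((m - 1) div 2)"
  have "P > 0" using p_ge_3 by (simp add: P_def)
  have P2: "P\<^sup>2 = int p ^ (m - 1)"
    using assms by (simp add: P_def flip: power_mult)
  have val: "sq_defect u = P \<or> sq_defect u = - P" if "u \<noteq> 0" for u
    using sq_defect_squared_odd[OF assms that] unfolding P2[symmetric] power2_eq_iff .
  have d0: "sq_defect 0 = 0" using sq_count_0_odd[OF assms] by (simp add: sq_defect_def)
  let ?A = "{u. sq_defect u = P}" and ?B = "{u. sq_defect u = - P}"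
  have un: "UNIV - {0} = ?A \<union> ?B" and dj: "?A \<inter> ?B = {}" using val d0 \<open>P > 0\<close> by auto
  have "card ?A + card ?B = card (UNIV - {0::'p mod_ring})"
    unfolding un by (rule card_Un_disjoint[symmetric]) (use dj in auto)
  then have 1: "int (card ?A) + int (card ?B) = int p - 1"
    using p_ge_3 by (simp add: card_Diff_subset card_p)
  have "0 = (\<Sum>u\<in>?A \<union> ?B. sq_defect u)"
    using sum_sq_defect sum.remove[of UNIV 0 sq_defect] d0 un by simp
  also have "\<dots> = (\<Sum>u\<in>?A. sq_defect u) + (\<Sum>u\<in>?B. sq_defect u)"
    by (rule sum.union_disjoint) (use dj in auto)
  also have "\<dots> = P * (int (card ?A) - int (card ?B))" by (simp add: algebra_simps)
  finally have "card ?A = card ?B" using \<open>P > 0\<close> by simp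
  with 1 show "2 * int (card {u. sq_defect u = int p ^ ((m - 1) div 2)}) = int p - 1"
    and "2 * int (card {u. sq_defect u = - (int p ^ ((m - 1) div 2))}) = int p - 1"
    unfolding P_def[symmetric] by simp_all
  show "u \<noteq> 0 \<Longrightarrow> sq_defect u = int p ^ ((m - 1) div 2) \<or> sq_defect u = - (int p ^ ((m - 1) div 2))"
    using val by (simp add: P_def)
qed

text \<open>Every \<open>u\<close> of deviation \<open>c\<close> comes from V u =
  \<open>p ^ (m - 1) + c\<close> elements \<open>a\<close>. This yields the coefficients of the last
  two sums for odd m.\<close>

lemma card_by_defect:
  "int (card {a::'k. sq_defect (tr (a\<^sup>2)) = c}) = int (card {u. sq_defect u = c}) * (int p ^ (m - 1) + c)"
proof -
  have "card {a::'k. sq_defect (tr (a\<^sup>2)) = c}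
      = (\<Sum>u\<in>{u. sq_defect u = c}. card {a \<in> {a. sq_defect (tr (a\<^sup>2)) = c}. tr (a\<^sup>2) = u})"
    using sum_fun_comp[of "{a::'k. sq_defect (tr (a\<^sup>2)) = c}" "{u. sq_defect u = c}"
        "\<lambda>a. tr (a\<^sup>2)" "\<lambda>_. 1::nat"]
    by (simp add: image_subset_iff)
  also have "\<dots> = (\<Sum>u\<in>{u. sq_defect u = c}. sq_count u)"
    by (rule sum.cong) (auto simp: sq_count_def intro!: arg_cong[where f = card])
  finally have "int (card {a::'k. sq_defect (tr (a\<^sup>2)) = c}) = (\<Sum>u\<in>{u. sq_defect u = c}. int (sq_count u))"
    by simp
  also have "\<dots> = (\<Sum>u\<in>{u. sq_defect u = c}. int p ^ (m - 1) + c)"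
    by (rule sum.cong) (auto simp: sq_defect_def)
  finally show ?thesis by simp
qed

lemma of_nat_eq_of_int_of_nat: "(of_nat k :: 'p mod_ring enum_poly) = of_int (int k)"
  by simp

section \<open>Assembling the enumerators\<close>

lemma CWE_odd:
  assumes m: "odd m" "m \<ge> 3" and d: "bij_betw d {..<n} isotropic"
  shows "n = p ^ (m - 1) - 1"
    and "is_linear_code n (m + 1) (trace_code m n d :: 'p mod_ring vec set)"
    and "CWE (trace_code m n d :: 'p mod_ring vec set) =
      weight_orbit (p ^ (m - 1) - 1) 0
      + of_int (int p ^ (m - 1) - 1) * weight_orbit (p ^ (m - 2) - 1) (p ^ (m - 2))
      + of_int ((int p - 1) div 2 * (int p ^ (m - 1) + int p ^ ((m - 1) div 2))) *
        weight_orbit (p ^ (m - 2) - 1 + (p - 1) * p ^ ((m - 3) div 2)) (p ^ (m - 2) - p ^ ((m - 3) div 2))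
      + of_int ((int p - 1) div 2 * (int p ^ (m - 1) - int p ^ ((m - 1) div 2))) *
        weight_orbit (p ^ (m - 2) - 1 - (p - 1) * p ^ ((m - 3) div 2)) (p ^ (m - 2) + p ^ ((m - 3) div 2))"
proof -
  define Q where "Q = p ^ ((m - 3) div 2)"
  define M where "M = p ^ (m - 2)"
  define R where "R = int p ^ ((m - 1) div 2)"
  have "R > 0" using p_ge_3 by (simp add: R_def)
  \<comment> \<open>Guarantees that the natural-number subtractions in the exponents are not
    truncated, and that the tail \<open>M - Q\<close> is positive. For \<open>m = 3\<close> it is an
    equality.\<close>
  have QM: "p * Q \<le> M"
  proof -
    have "p * Q = p ^ Suc ((m - 3) div 2)" by (simp add: Q_def)
    also have "\<dots> \<le> M" unfolding M_def using m p_ge_3 by (intro power_increasing) auto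
    finally show ?thesis .
  qed
  have "Q > 0" using p_ge_3 by (simp add: Q_def)
  then have "Q < p * Q" using p_ge_3 by simp
  have pQ: "(p - 1) * Q = p * Q - Q" by (simp add: diff_mult_distrib)
  have V0: "sq_count 0 = p ^ (m - 1)" by (rule sq_count_0_odd[OF m(1)])
  have card_n: "n = card isotropic" using bij_betw_same_card[OF d] by simp
  then show n: "n = p ^ (m - 1) - 1" by (simp add: card_isotropic V0)
  have pM: "p ^ (m - 1) = p * M"
  proof -
    have "m - 1 = Suc (m - 2)" using m by simp
    then show ?thesis by (simp only: power_Suc M_def)
  qed
  have "p * M \<ge> 3 * 1"
    using \<open>Q > 0\<close> \<open>Q < p * Q\<close> QM by (intro mult_le_mono p_ge_3) linarith
  then have "n \<ge> 1" using n pM by simp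
  have plus: "sq_count_orth a - 1 = M - 1 + (p - 1) * Q" "sq_count_tail a = M - Q"
    if "sq_defect (tr (a\<^sup>2)) = R" for a
  proof -
    have a: "tr (a\<^sup>2) \<noteq> 0" "sq_defect (tr (a\<^sup>2)) = 1 * int p ^ ((m - 1) div 2)"
      using that V0 \<open>R > 0\<close> by (auto simp: sq_defect_def R_def)
    note c = anisotropic_counts_odd[OF m a]
    have "int (sq_count_orth a) = int (M + (p - 1) * Q)"
      unfolding c using p_ge_3 by (simp add: M_def Q_def of_nat_diff)
    then show "sq_count_orth a - 1 = M - 1 + (p - 1) * Q"
      using QM \<open>Q < p * Q\<close> by (simp only: of_nat_eq_iff)
    have "int (sq_count_tail a) = int (M - Q)"
      unfolding c using QM \<open>Q < p * Q\<close> by (simp add: M_def Q_def of_nat_diff)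
    then show "sq_count_tail a = M - Q" by (simp only: of_nat_eq_iff)
  qed
  have minus: "sq_count_orth a - 1 = M - 1 - (p - 1) * Q" "sq_count_tail a = M + Q"
    if "sq_defect (tr (a\<^sup>2)) = - R" for a
  proof -
    have a: "tr (a\<^sup>2) \<noteq> 0" "sq_defect (tr (a\<^sup>2)) = -1 * int p ^ ((m - 1) div 2)"
      using that V0 \<open>R > 0\<close> by (auto simp: sq_defect_def R_def)
    note c = anisotropic_counts_odd[OF m a]
    have "int (sq_count_orth a) + int ((p - 1) * Q) = int M"
      unfolding c using p_ge_3 by (simp add: M_def Q_def of_nat_diff algebra_simps)
    then have "sq_count_orth a + (p - 1) * Q = M" by linarith
    then show "sq_count_orth a - 1 = M - 1 - (p - 1) * Q" by linarith
    have "int (sq_count_tail a) = int (M + Q)"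
      unfolding c by (simp add: M_def Q_def)
    then show "sq_count_tail a = M + Q" by (simp only: of_nat_eq_iff)
  qed
  have cases: "sq_defect (tr (a\<^sup>2)) = R \<or> sq_defect (tr (a\<^sup>2)) = - R" if "tr (a\<^sup>2) \<noteq> 0" for a
    using card_defect_values_odd(3)[OF m(1) that] by (simp add: R_def)
  have tail: "sq_count_tail a > 0" if "a \<noteq> 0" for a
  proof (cases "tr (a\<^sup>2) = 0")
    case True
    then show ?thesis
      using card_sq_orth_isotropic[OF that] m p_ge_3 by (simp add: sq_count_tail_def)
  next
    case False
    then show ?thesis using cases[OF False] plus(2)[of a] minus(2)[of a] QM \<open>Q < p * Q\<close> \<open>Q > 0\<close>
      by linarith
  qed
  show "is_linear_code n (m + 1) (trace_code m n d :: 'p mod_ring vec set)"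
    by (rule is_linear_trace_code[OF d \<open>n \<ge> 1\<close> tail])
  let ?g = "\<lambda>a. weight_orbit (sq_count_orth a - 1) (sq_count_tail a)"
  let ?A = "{a::'k. sq_defect (tr (a\<^sup>2)) = R}" and ?B = "{a::'k. sq_defect (tr (a\<^sup>2)) = - R}"
  have cA: "int (card ?A) = (int p - 1) div 2 * (int p ^ (m - 1) + R)"
    and cB: "int (card ?B) = (int p - 1) div 2 * (int p ^ (m - 1) - R)"
    unfolding card_by_defect using card_defect_values_odd(1,2)[OF m(1), folded R_def] by auto
  have "{a::'k. tr (a\<^sup>2) \<noteq> 0} = ?A \<union> ?B"
    using cases V0 \<open>R > 0\<close> by (auto simp: sq_defect_def)
  then have "sum ?g {a. tr (a\<^sup>2) \<noteq> 0} = sum ?g ?A + sum ?g ?B"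
    using \<open>R > 0\<close> by (simp add: sum.union_disjoint disjoint_iff)
  also have "sum ?g ?A = of_nat (card ?A) * weight_orbit (M - 1 + (p - 1) * Q) (M - Q)"
    using plus by simp
  also have "sum ?g ?B = of_nat (card ?B) * weight_orbit (M - 1 - (p - 1) * Q) (M + Q)"
    using minus by simp
  finally have aniso: "sum ?g {a. tr (a\<^sup>2) \<noteq> 0} =
      of_int ((int p - 1) div 2 * (int p ^ (m - 1) + R)) * weight_orbit (M - 1 + (p - 1) * Q) (M - Q)
      + of_int ((int p - 1) div 2 * (int p ^ (m - 1) - R)) * weight_orbit (M - 1 - (p - 1) * Q) (M + Q)"
    by (simp only: of_nat_eq_of_int_of_nat cA cB)
  have iso: "p ^ (m - 1) - 1 - (p - 1) * M = M - 1"
    unfolding pM using \<open>p * M \<ge> 3 * 1\<close> p_ge_3 by (simp add: diff_mult_distrib)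
  have len: "int (p ^ (m - 1) - 1) = int p ^ (m - 1) - 1"
    using p_ge_3 by (simp add: of_nat_diff)
  have "m \<ge> 2" using m by simp
  have "CWE (trace_code m n d :: 'p mod_ring vec set) = sum ?g UNIV"
    by (rule CWE_trace_code[OF d \<open>n \<ge> 1\<close> tail])
  then show "CWE (trace_code m n d :: 'p mod_ring vec set) =
      weight_orbit (p ^ (m - 1) - 1) 0
      + of_int (int p ^ (m - 1) - 1) * weight_orbit (p ^ (m - 2) - 1) (p ^ (m - 2))
      + of_int ((int p - 1) div 2 * (int p ^ (m - 1) + int p ^ ((m - 1) div 2))) *
        weight_orbit (p ^ (m - 2) - 1 + (p - 1) * p ^ ((m - 3) div 2)) (p ^ (m - 2) - p ^ ((m - 3) div 2))
      + of_int ((int p - 1) div 2 * (int p ^ (m - 1) - int p ^ ((m - 1) div 2))) *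
        weight_orbit (p ^ (m - 2) - 1 - (p - 1) * p ^ ((m - 3) div 2)) (p ^ (m - 2) + p ^ ((m - 3) div 2))"
    unfolding sum_weight_orbit_by_norm[OF \<open>m \<ge> 2\<close>] V0 aniso
    unfolding Q_def[symmetric] R_def[symmetric] M_def[symmetric] iso of_nat_eq_of_int_of_nat len
    by (simp only: add.assoc)
qed

text \<open>With \<open>Q = p ^ (h - 1)\<close> and \<open>\<epsilon> = 1\<close> the length factors
  as (Q - 1)(pQ + 1); for \<open>\<epsilon> = -1\<close> it is positive. So \<open>n \<ge> 1\<close>
  excludes exactly \<open>m = 2\<close> with \<open>\<epsilon> = 1\<close>, where D is empty and the
  code, of length 0, cannot have dimension \<open>m + 1\<close>.\<close>

lemma CWE_even:
  assumes m: "m = 2 * h" and d: "bij_betw d {..<n} isotropic"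
  defines "\<epsilon> \<equiv> (-1::int) ^ (h * ((p - 1) div 2)\<^sup>2)"
  shows "int n = int p ^ (m - 1) - 1 - \<epsilon> * (int p - 1) * int p ^ (h - 1)"
    and "n \<ge> 1 \<Longrightarrow> is_linear_code n (m + 1) (trace_code m n d :: 'p mod_ring vec set)"
    and "n \<ge> 1 \<Longrightarrow> CWE (trace_code m n d :: 'p mod_ring vec set) =
      weight_orbit (nat (int p ^ (m - 1) - 1 - \<epsilon> * (int p - 1) * int p ^ (h - 1))) 0
      + of_int (int p ^ (m - 1) - 1 - \<epsilon> * (int p - 1) * int p ^ (h - 1)) *
        weight_orbit (nat (int p ^ (m - 2) - 1 - \<epsilon> * (int p - 1) * int p ^ (h - 1))) (p ^ (m - 2))
      + of_int ((int p - 1) * (int p ^ (m - 1) + \<epsilon> * int p ^ (h - 1))) *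
        weight_orbit (p ^ (m - 2) - 1) (nat (int p ^ (m - 2) - \<epsilon> * int p ^ (h - 1)))"
proof -
  have "h > 0" "m \<ge> 2" using m m_pos by simp_all
  define Q where "Q = int p ^ (h - 1)"
  have "Q \<ge> 1" using p_ge_3 by (simp add: Q_def)
  have V0: "int (sq_count 0) = int p ^ (m - 1) - \<epsilon> * (int p - 1) * Q"
    using sq_count_0_even[OF m] by (simp add: \<epsilon>_def Q_def)
  have eps: "\<epsilon> = 1 \<or> \<epsilon> = -1" by (simp add: \<epsilon>_def minus_one_power_iff)
  have card_n: "n = sq_count 0 - 1" using bij_betw_same_card[OF d] by (simp add: card_isotropic)
  then have n_int: "int n = int (sq_count 0) - 1"
    using sq_count_0_pos by (simp add: of_nat_diff)
  then show n: "int n = int p ^ (m - 1) - 1 - \<epsilon> * (int p - 1) * int p ^ (h - 1)"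
    by (simp add: V0 Q_def)
  note aniso = anisotropic_counts_even[OF m, folded \<epsilon>_def Q_def]
  have MQ: "int p ^ (m - 2) = Q * Q"
  proof -
    have "m - 2 = (h - 1) + (h - 1)" using m by simp
    then show ?thesis by (simp only: Q_def power_add)
  qed
  have pM: "int p ^ (m - 1) = int p * (Q * Q)"
    using power_shift[OF \<open>m \<ge> 2\<close>] MQ by simp
  have tail: "sq_count_tail a > 0" if "a \<noteq> 0" "n \<ge> 1" for a
  proof (cases "tr (a\<^sup>2) = 0")
    case True
    then show ?thesis
      using card_sq_orth_isotropic[OF that(1) _ \<open>m \<ge> 2\<close>] p_ge_3 by (simp add: sq_count_tail_def)
  next
    case False
    \<comment> \<open>The tail is Q(Q - \<open>\<epsilon>\<close>). If it vanished, \<open>Q\<close>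
      would be 1 and V 0 would be 1, leaving only the zero vector isotropic and D empty.\<close>
    have "int (sq_count_tail a) \<noteq> 0"
    proof
      assume "int (sq_count_tail a) = 0"
      then have "int (sq_count 0) = Q * Q"
        using anisotropic_counts(2)[OF False] aniso(1)[OF False] MQ by simp
      moreover have "Q * (Q - \<epsilon>) = 0"
        using aniso(2)[OF False] \<open>int (sq_count_tail a) = 0\<close> MQ by (auto simp: algebra_simps)
      then have "Q = 1" using eps \<open>Q \<ge> 1\<close> by auto
      ultimately have "sq_count 0 = 1" by simp
      then show False using card_n that(2) by simp
    qed
    then show ?thesis by simp
  qed
  show "is_linear_code n (m + 1) (trace_code m n d :: 'p mod_ring vec set)" if "n \<ge> 1"
    by (rule is_linear_trace_code[OF d that tail[OF _ that]])
  let ?g = "\<lambda>a. weight_orbit (sq_count_orth a - 1) (sq_count_tail a)"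
  let ?A = "{a::'k. tr (a\<^sup>2) \<noteq> 0}"
  have "?g a = weight_orbit (p ^ (m - 2) - 1) (nat (int p ^ (m - 2) - \<epsilon> * Q))" if "a \<in> ?A" for a
  proof -
    have "int (sq_count_orth a) = int (p ^ (m - 2))" using aniso(1)[of a] that by simp
    then have "sq_count_orth a = p ^ (m - 2)" by (simp only: of_nat_eq_iff)
    moreover have "sq_count_tail a = nat (int p ^ (m - 2) - \<epsilon> * Q)"
      using aniso(2)[of a] that by (metis mem_Collect_eq nat_int)
    ultimately show ?thesis by simp
  qed
  then have "sum ?g ?A = of_nat (card ?A) * weight_orbit (p ^ (m - 2) - 1) (nat (int p ^ (m - 2) - \<epsilon> * Q))"
    by simp
  moreover have "int (card ?A) = (int p - 1) * (int p ^ (m - 1) + \<epsilon> * Q)"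
  proof -
    have "?A = UNIV - {a. tr (a\<^sup>2) = 0}" by auto
    then have "card ?A = p ^ m - sq_count 0"
      by (simp add: card_Diff_subset sq_count_def card_k)
    moreover have "sq_count 0 \<le> p ^ m"
      unfolding sq_count_def card_k[symmetric] by (rule card_mono) auto
    ultimately have "int (card ?A) = int p ^ m - int (sq_count 0)" by (simp add: of_nat_diff)
    moreover have "int p ^ m = int p * int p ^ (m - 1)" using m_pos by (cases m) simp_all
    ultimately show ?thesis by (simp add: V0 algebra_simps)
  qed
  ultimately have aniso_sum: "sum ?g ?A = of_int ((int p - 1) * (int p ^ (m - 1) + \<epsilon> * Q)) *
      weight_orbit (p ^ (m - 2) - 1) (nat (int p ^ (m - 2) - \<epsilon> * Q))"
    by (simp only: of_nat_eq_of_int_of_nat)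
  have len: "sq_count 0 - 1 = n" by (simp add: card_n)
  \<comment> \<open>Natural subtraction and \<open>nat\<close> truncate alike, so comparing the
    integer differences suffices, whatever their sign.\<close>
  have iso: "n - (p - 1) * p ^ (m - 2) = nat (int p ^ (m - 2) - 1 - \<epsilon> * (int p - 1) * Q)"
  proof -
    have "int ((p - 1) * p ^ (m - 2)) = (int p - 1) * (Q * Q)"
      using p_ge_3 by (simp add: of_nat_diff MQ)
    then have "int n - int ((p - 1) * p ^ (m - 2)) = int p ^ (m - 2) - 1 - \<epsilon> * (int p - 1) * Q"
      unfolding n_int V0 pM MQ by (simp add: algebra_simps)
    then show ?thesis by linarith
  qed
  show "CWE (trace_code m n d :: 'p mod_ring vec set) =
      weight_orbit (nat (int p ^ (m - 1) - 1 - \<epsilon> * (int p - 1) * int p ^ (h - 1))) 0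
      + of_int (int p ^ (m - 1) - 1 - \<epsilon> * (int p - 1) * int p ^ (h - 1)) *
        weight_orbit (nat (int p ^ (m - 2) - 1 - \<epsilon> * (int p - 1) * int p ^ (h - 1))) (p ^ (m - 2))
      + of_int ((int p - 1) * (int p ^ (m - 1) + \<epsilon> * int p ^ (h - 1))) *
        weight_orbit (p ^ (m - 2) - 1) (nat (int p ^ (m - 2) - \<epsilon> * int p ^ (h - 1)))"
    if "n \<ge> 1"
  proof -
    have "CWE (trace_code m n d :: 'p mod_ring vec set) = sum ?g UNIV"
      by (rule CWE_trace_code[OF d that tail[OF _ that]])
    then show ?thesis
      unfolding n[symmetric] nat_int
      unfolding Q_def[symmetric] sum_weight_orbit_by_norm[OF \<open>m \<ge> 2\<close>] aniso_sum len iso of_nat_eq_of_int_of_nat .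
  qed
qed

end

text \<open>The map \<open>d\<close> is an arbitrary enumeration of D. In each parity case the
  halvings are exact. For even \<open>m\<close> the exponents that involve \<open>\<epsilon>\<close>
  are formed in the integers and brought back by \<open>nat\<close>.\<close>

theorem theorem4:
  fixes p m n :: nat
    and d :: "nat \<Rightarrow> 'k::{field,finite}"
    and C :: "'p::prime_card mod_ring vec set"
    and \<epsilon> :: int
  assumes p: "CARD('p) = p" "odd p"
    and m: "m > 0" "CARD('k) = p ^ m"
    and d: "bij_betw d {..<n} (defining_set TYPE('p) m)"
    and C: "C = trace_code m n d"
    and \<epsilon>: "\<epsilon> = (-1) ^ ((m div 2) * ((p - 1) div 2) ^ 2)"
  shows
    "(m \<ge> 3 \<and> odd m \<longrightarrow>
        n = p ^ (m - 1) - 1 \<and>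
        is_linear_code n (m + 1) C \<and>
        CWE C =
          (\<Sum>b\<in>UNIV. w b ^ (p ^ (m - 1) - 1))
          + of_int (int p ^ (m - 1) - 1) *
            (\<Sum>b\<in>UNIV. w b ^ (p ^ (m - 2) - 1) * (\<Prod>\<rho>\<in>UNIV - {b}. w \<rho> ^ (p ^ (m - 2))))
          + of_int ((int p - 1) div 2 * (int p ^ (m - 1) + int p ^ ((m - 1) div 2))) *
            (\<Sum>b\<in>UNIV. w b ^ (p ^ (m - 2) - 1 + (p - 1) * p ^ ((m - 3) div 2)) *
               (\<Prod>\<rho>\<in>UNIV - {b}. w \<rho> ^ (p ^ (m - 2) - p ^ ((m - 3) div 2))))
          + of_int ((int p - 1) div 2 * (int p ^ (m - 1) - int p ^ ((m - 1) div 2))) *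
            (\<Sum>b\<in>UNIV. w b ^ (p ^ (m - 2) - 1 - (p - 1) * p ^ ((m - 3) div 2)) *
               (\<Prod>\<rho>\<in>UNIV - {b}. w \<rho> ^ (p ^ (m - 2) + p ^ ((m - 3) div 2)))))
     \<and>
     (m \<ge> 2 \<and> even m \<longrightarrow>
        int n = int p ^ (m - 1) - 1 - \<epsilon> * (int p - 1) * int p ^ ((m - 2) div 2) \<and>
        (n \<ge> 1 \<longrightarrow>
          is_linear_code n (m + 1) C \<and>
          CWE C =
            (\<Sum>b\<in>UNIV. w b ^ nat (int p ^ (m - 1) - 1 - \<epsilon> * (int p - 1) * int p ^ ((m - 2) div 2)))
            + of_int (int p ^ (m - 1) - 1 - \<epsilon> * (int p - 1) * int p ^ ((m - 2) div 2)) *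
              (\<Sum>b\<in>UNIV.
                 w b ^ nat (int p ^ (m - 2) - 1 - \<epsilon> * (int p - 1) * int p ^ ((m - 2) div 2)) *
                 (\<Prod>\<rho>\<in>UNIV - {b}. w \<rho> ^ (p ^ (m - 2))))
            + of_int ((int p - 1) * (int p ^ (m - 1) + \<epsilon> * int p ^ ((m - 2) div 2))) *
              (\<Sum>b\<in>UNIV. w b ^ (p ^ (m - 2) - 1) *
                 (\<Prod>\<rho>\<in>UNIV - {b}.
                    w \<rho> ^ nat (int p ^ (m - 2) - \<epsilon> * int p ^ ((m - 2) div 2))))))"
proof -
  interpret odd_trace p m "TYPE('p)" "TYPE('k)"
    by unfold_locales (use p m in auto)
  have d': "bij_betw d {..<n} isotropic"
    using d by (simp add: isotropic_def defining_set_def)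
  have orbit_0: "weight_orbit r 0 = (\<Sum>b\<in>UNIV. w b ^ r)" for r
    by (simp add: weight_orbit_def)
  show ?thesis
  proof (intro conjI impI; (elim conjE)?)
    assume "m \<ge> 3" "odd m"
    note odd_case = CWE_odd[OF this(2,1) d', folded C, unfolded orbit_0, unfolded weight_orbit_def]
    show "n = p ^ (m - 1) - 1" by (rule odd_case(1))
    show "is_linear_code n (m + 1) C" by (rule odd_case(2))
    show "CWE C = (\<Sum>b\<in>UNIV. w b ^ (p ^ (m - 1) - 1))
          + of_int (int p ^ (m - 1) - 1) *
            (\<Sum>b\<in>UNIV. w b ^ (p ^ (m - 2) - 1) * (\<Prod>\<rho>\<in>UNIV - {b}. w \<rho> ^ (p ^ (m - 2))))
          + of_int ((int p - 1) div 2 * (int p ^ (m - 1) + int p ^ ((m - 1) div 2))) *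
            (\<Sum>b\<in>UNIV. w b ^ (p ^ (m - 2) - 1 + (p - 1) * p ^ ((m - 3) div 2)) *
               (\<Prod>\<rho>\<in>UNIV - {b}. w \<rho> ^ (p ^ (m - 2) - p ^ ((m - 3) div 2))))
          + of_int ((int p - 1) div 2 * (int p ^ (m - 1) - int p ^ ((m - 1) div 2))) *
            (\<Sum>b\<in>UNIV. w b ^ (p ^ (m - 2) - 1 - (p - 1) * p ^ ((m - 3) div 2)) *
               (\<Prod>\<rho>\<in>UNIV - {b}. w \<rho> ^ (p ^ (m - 2) + p ^ ((m - 3) div 2))))"
      by (rule odd_case(3))
  next
    assume "even m" "m \<ge> 2"
    then have h: "m = 2 * (m div 2)" "m div 2 - 1 = (m - 2) div 2" by simp_all
    note even_case = CWE_even[OF h(1) d', folded C, folded \<epsilon>, unfolded h(2) orbit_0, unfolded weight_orbit_def]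
    show "int n = int p ^ (m - 1) - 1 - \<epsilon> * (int p - 1) * int p ^ ((m - 2) div 2)"
      by (rule even_case(1))
    assume "n \<ge> 1"
    note even_case = even_case(2,3)[OF this]
    show "is_linear_code n (m + 1) C" by (rule even_case(1))
    show "CWE C =
            (\<Sum>b\<in>UNIV. w b ^ nat (int p ^ (m - 1) - 1 - \<epsilon> * (int p - 1) * int p ^ ((m - 2) div 2)))
            + of_int (int p ^ (m - 1) - 1 - \<epsilon> * (int p - 1) * int p ^ ((m - 2) div 2)) *
              (\<Sum>b\<in>UNIV.
                 w b ^ nat (int p ^ (m - 2) - 1 - \<epsilon> * (int p - 1) * int p ^ ((m - 2) div 2)) *
                 (\<Prod>\<rho>\<in>UNIV - {b}. w \<rho> ^ (p ^ (m - 2))))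
            + of_int ((int p - 1) * (int p ^ (m - 1) + \<epsilon> * int p ^ ((m - 2) div 2))) *
              (\<Sum>b\<in>UNIV. w b ^ (p ^ (m - 2) - 1) *
                 (\<Prod>\<rho>\<in>UNIV - {b}.
                    w \<rho> ^ nat (int p ^ (m - 2) - \<epsilon> * int p ^ ((m - 2) div 2))))"
      by (rule even_case(2))
  qed
qed

end
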